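(* Consider the adaptive GLM insurance pricing model described in the context, and let $L_1(t)=c\sqrt{t\log t}$ for some constant $c>0$. Suppose the MQLE $\widehat{\beta}_t$ is strongly consistent, i.e. $\widehat\beta_t\to\beta_0$ almost surely. Suppose further that there exist $t_0\in\mathbb N$ and a constant $K>0$ such that: (1) $\lambda_{\min}(t)\ge L_1(t)$ almost surely for all $t\ge t_0$; (2) $\sum_{t=1}^{T}\bigl|p_t-p(\widehat{\beta}_t)\bigr|^2\le K\,L_1(T)$ almost surely for all $T\ge t_0$. Then, as $T\to\infty$, $$\mathrm{Regret}(T)=O\Bigl(L_1(T)+\sum_{t=1}^{T}\frac{\log t}{L_1(t)}\Bigr).$$ In particular, $\mathrm{Regret}(T)=O\bigl(\sqrt{T\log T}\bigr)$.
   Context: Prices lie in $\mathcal P=[p_l,p_h]$ with $0<p_l<p_h$. At each period $t=1,2,\dots$ a price $p_t\in\mathcal P$ is chosen; write $\mathbf p(t)=(1,p_t)^\top$. Let $(\mathcal F_t)$ be the filtration generated by past prices and observations, and assume $p_t$ is $\mathcal F_{t-1}$-measurable. The design matrix is $P_t=\sum_{i=1}^t\mathbf p(i)\mathbf p(i)^\top$, with smallest and largest eigenvalues $\lambda_{\min}(t)$ and $\lambda_{\max}(t)$. Demand and claims model. The observed demand $d_t$ satisfies $\mathbb E[d_t\mid\mathcal F_{t-1}]=h_1(a_0+a_1p_t)$, and the observed total claims $c_t>0$ satisfy $\mathbb E[\log c_t\mid\mathcal F_{t-1}]=h_2(b_0+b_1p_t)$. The true parameter is $\beta_0=(a,b)$,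 where $a=(a_0,a_1)^\top$ and $b=(b_0,b_1)^\top$ are unknown. The link functions $h_1,h_2$ are known, continuously differentiable and canonical, with strictly positive derivatives. The MQLE (maximum quasi-likelihood estimator) is $\widehat\beta_t=(\widehat a_t,\widehat b_t)$, where $\sum_{i=1}^t\mathbf p(i)\bigl(d_i-h_1(\mathbf p(i)^\top\widehat a_t)\bigr)=0$ and $\sum_{i=1}^t\mathbf p(i)\bigl(\log c_i-h_2(\mathbf p(i)^\top\widehat b_t)\bigr)=0$. The errors $\eta_i=d_i-h_1(\mathbf p(i)^\top a)$ and $\eta_i=\log c_i-h_2(\mathbf p(i)^\top b)$ are martingale differences with respect to $(\mathcal F_i)$. Each satisfies assumption (A1): there are $\sigma^2<\infty$ and $\gamma>2$ with $\sup_i\mathbb E[\eta_i^2\mid\mathcal F_{i-1}]\le\sigma^2$ almost surely and $\sup_i\mathbb E|\eta_i|^\gamma<\infty$. Revenue. $r(p,\beta)$ denotes the expected one-period revenue (premium income $p\cdot$demand minus claims) at price $p$ under parameter $\beta$. It is assumed that: - $r$ is twice continuously differentiable in $(p,\beta)$ on $\mathcal P\times V$, where $V$ is an open bounded neighbourhood of $\beta_0$; - for every $\beta\in V$, $r(\cdot,\beta)$ has a unique maximizer $p(\beta)\in\mathcal P$; - $p^*=p(\beta_0)\in(p_l,p_h)$, with $\partial r(p^*,\beta_0)/\partial p=0$ and $\partial^2 r(p^*,\beta_0)/\partial p^2<0$. The cumulative regret is $\mathrm{Regret}(T)=\mathbb E\bigl[\sum_{t=1}^T\bigl(r(p^*,\beta_0)-r(p_t,\beta_0)\bigr)\bigr]$.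 *)

theory Defs
  imports "HOL-Probability.Probability" "HOL-Library.Landau_Symbols"
begin

text \<open>Parameters beta = (a, b) with a = (a0, a1), b = (b0, b1).\<close>
type_synonym param = "(real \<times> real) \<times> (real \<times> real)"

definition vec2 :: "real \<times> real \<Rightarrow> real^2" where
  "vec2 x = vector [fst x, snd x]"

definition pvec :: "real \<Rightarrow> real^2" where
  "pvec x = vector [1, x]"

definition design_matrix :: "(nat \<Rightarrow> real) \<Rightarrow> nat \<Rightarrow> real^2^2" where
  "design_matrix q t = (\<Sum>i\<in>{1..t}. (\<chi> j k. pvec (q i) $ j * pvec (q i) $ k))"

definition lambda_min :: "real^2^2 \<Rightarrow> real" where
  "lambda_min A = Min {l. \<exists>v::real^2. v \<noteq> 0 \<and> A *v v = l *\<^sub>R v}"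

text \<open>Filtration generated by past prices and observations (prices, demands, claims up to t).\<close>
definition hist_alg :: "'a measure \<Rightarrow> (nat \<Rightarrow> 'a \<Rightarrow> real) \<Rightarrow> (nat \<Rightarrow> 'a \<Rightarrow> real)
    \<Rightarrow> (nat \<Rightarrow> 'a \<Rightarrow> real) \<Rightarrow> nat \<Rightarrow> 'a measure" where
  "hist_alg M p d c t = sigma (space M)
     (\<Union>i\<in>{1..t}. \<Union>X\<in>{p i, d i, c i}. {X -` B \<inter> space M | B. B \<in> sets borel})"

definition mds :: "'a measure \<Rightarrow> (nat \<Rightarrow> 'a measure) \<Rightarrow> (nat \<Rightarrow> 'a \<Rightarrow> real) \<Rightarrow> bool" where
  "mds M F \<eta> \<longleftrightarrow> (\<forall>i\<ge>1. \<eta> i \<in> borel_measurable (F i) \<and> integrable M (\<eta> i) \<and>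
      (AE \<omega> in M. real_cond_exp M (F (i - 1)) (\<eta> i) \<omega> = 0))"

definition A1 :: "'a measure \<Rightarrow> (nat \<Rightarrow> 'a measure) \<Rightarrow> (nat \<Rightarrow> 'a \<Rightarrow> real) \<Rightarrow> bool" where
  "A1 M F \<eta> \<longleftrightarrow> (\<exists>\<sigma>2 \<gamma> B. \<gamma> > 2 \<and>
      (\<forall>i\<ge>1. AE \<omega> in M. real_cond_exp M (F (i - 1)) (\<lambda>\<omega>. (\<eta> i \<omega>)\<^sup>2) \<omega> \<le> \<sigma>2) \<and>
      (\<forall>i\<ge>1. (\<integral>\<^sup>+\<omega>. ennreal (\<bar>\<eta> i \<omega>\<bar> powr \<gamma>) \<partial>M) \<le> ennreal B))"

definition is_MQLE :: "(nat \<Rightarrow> 'a \<Rightarrow> real) \<Rightarrow> (nat \<Rightarrow> 'a \<Rightarrow> real) \<Rightarrow> (nat \<Rightarrow> 'a \<Rightarrow> real)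
    \<Rightarrow> (real \<Rightarrow> real) \<Rightarrow> (real \<Rightarrow> real) \<Rightarrow> nat \<Rightarrow> 'a \<Rightarrow> param \<Rightarrow> bool" where
  "is_MQLE p d c h1 h2 t \<omega> \<beta> \<longleftrightarrow>
     (\<Sum>i\<in>{1..t}. (d i \<omega> - h1 (pvec (p i \<omega>) \<bullet> vec2 (fst \<beta>))) *\<^sub>R pvec (p i \<omega>)) = 0 \<and>
     (\<Sum>i\<in>{1..t}. (ln (c i \<omega>) - h2 (pvec (p i \<omega>) \<bullet> vec2 (snd \<beta>))) *\<^sub>R pvec (p i \<omega>)) = 0"

definition C2_on :: "('x::real_normed_vector \<Rightarrow> real) \<Rightarrow> 'x set \<Rightarrow> bool" where
  "C2_on f S \<longleftrightarrow> (\<exists>(Df :: 'x \<Rightarrow> ('x \<Rightarrow>\<^sub>L real)) (D2f :: 'x \<Rightarrow> ('x \<Rightarrow>\<^sub>L ('x \<Rightarrow>\<^sub>L real))).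
      (\<forall>x\<in>S. (f has_derivative blinfun_apply (Df x)) (at x within S)) \<and>
      (\<forall>x\<in>S. (Df has_derivative blinfun_apply (D2f x)) (at x within S)) \<and>
      continuous_on S D2f)"

definition L1 :: "real \<Rightarrow> nat \<Rightarrow> real" where
  "L1 cL t = cL * sqrt (real t * ln (real t))"

definition regret :: "'a measure \<Rightarrow> (real \<Rightarrow> param \<Rightarrow> real) \<Rightarrow> param \<Rightarrow> real
    \<Rightarrow> (nat \<Rightarrow> 'a \<Rightarrow> real) \<Rightarrow> nat \<Rightarrow> real" where
  "regret M r \<beta>0 pst p T = (\<integral>\<omega>. (\<Sum>t\<in>{1..T}. r pst \<beta>0 - r (p t \<omega>) \<beta>0) \<partial>M)"

end

theory Submission
  imports Defs
begin

text \<open>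
  Since \<open>p\<^sup>*\<close> is an interior nondegenerate maximiser, the regret of a price is at most
  \<open>C (p - p\<^sup>*)\<^sup>2\<close>, and \<open>(p(\<beta>) - p\<^sup>*)\<^sup>2 \<le> C min(1, |\<beta> - \<beta>\<^sub>0|\<^sup>2)\<close> for \<^emph>\<open>all\<close> \<open>\<beta>\<close>. It therefore suffices to
  bound \<open>E min(1, |\<beta>\<^sub>t - \<beta>\<^sub>0|\<^sup>2)\<close> for the estimator \<open>\<beta>\<^sub>t\<close> by a multiple of \<open>log t / L\<^sub>1(t)\<close>.

  The links are increasing, so along a ray from the true parameter the score only grows; comparing
  with its value at distance at most one gives, pathwise,
  \<open>min(1, |\<beta>\<^sub>t - \<beta>\<^sub>0|\<^sup>2) \<lambda>\<^sub>m\<^sub>i\<^sub>n(t) \<le> C Q\<^sub>t\<close> with \<open>Q\<^sub>t = Z\<^sub>t\<^sup>T (I + P\<^sub>t)\<^sup>-\<^sup>1 Z\<^sub>t\<close> and \<open>Z\<^sub>t = \<Sum>\<eta>\<^sub>i p(i)\<close>. If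
  the quasi-likelihood equations have no solution, Brouwer's theorem produces a unit direction in
  which the same computation yields \<open>\<lambda>\<^sub>m\<^sub>i\<^sub>n(t) \<le> C Q\<^sub>t\<close>. Finally the Sherman--Morrison formula and the
  martingale property give \<open>E Q\<^sub>t \<le> \<sigma>\<^sup>2 E ln det (I + P\<^sub>t) = O(log t)\<close>.
\<close>

section \<open>The self-normalised martingale\<close>

text \<open>With \<open>V = I + P\<^sub>t\<close> (regularised, hence invertible for every \<open>t\<close>) and
  \<open>Z = (\<Sum>e i, \<Sum>e i * q i)\<close>: the three definitions are \<open>det V\<close>, the bilinear form of the
  adjugate of \<open>V\<close>, and \<open>Z\<^sup>T V\<^sup>-\<^sup>1 Z\<close>.\<close>

definition det_reg :: "(nat \<Rightarrow> real) \<Rightarrow> nat \<Rightarrow> real" where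
  "det_reg q t = (1 + real t) * (1 + (\<Sum>i\<in>{1..t}. (q i)\<^sup>2)) - (\<Sum>i\<in>{1..t}. q i)\<^sup>2"

definition adj_form :: "(nat \<Rightarrow> real) \<Rightarrow> nat \<Rightarrow> real \<Rightarrow> real \<Rightarrow> real \<Rightarrow> real \<Rightarrow> real" where
  "adj_form q t x y x' y' = (1 + (\<Sum>i\<in>{1..t}. (q i)\<^sup>2)) * x * x'
     - (\<Sum>i\<in>{1..t}. q i) * (x * y' + y * x') + (1 + real t) * y * y'"

definition self_norm :: "(nat \<Rightarrow> real) \<Rightarrow> (nat \<Rightarrow> real) \<Rightarrow> nat \<Rightarrow> real" where
  "self_norm q e t = adj_form q t (\<Sum>i\<in>{1..t}. e i) (\<Sum>i\<in>{1..t}. e i * q i)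
       (\<Sum>i\<in>{1..t}. e i) (\<Sum>i\<in>{1..t}. e i * q i) / det_reg q t"

text \<open>In dimension two the adjugate is linear in the matrix, and the adjugate of x x^T with x
  = (1, q) is the rank-one form given by the cross product with x. A new regressor therefore adds a
  single product.\<close>

lemma adj_form_Suc:
  "adj_form q (Suc t) x y x' y' =
     adj_form q t x y x' y' + (x * q (Suc t) - y) * (x' * q (Suc t) - y')"
  by (simp add: adj_form_def algebra_simps power2_eq_square)

text \<open>The matrix determinant lemma, det(V + x x^T) = det V + x^T adj(V) x, for x = (1,
  \<open>q (Suc t)\<close>).\<close>

lemma det_reg_Suc: "det_reg q (Suc t) = det_reg q t + adj_form q t 1 (q (Suc t)) 1 (q (Suc t))"
  by (simp add: adj_form_def det_reg_def algebra_simps power2_eq_square)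

text \<open>Complete the square in \<open>y\<close>. The sign of the determinant is a hypothesis
  here because this form drives the induction that proves \<open>det_reg_ge_1\<close>.\<close>

lemma adj_form_nonneg_aux:
  assumes "det_reg q t \<ge> 0" shows "adj_form q t x y x y \<ge> 0"
proof -
  have "(1 + real t) * adj_form q t x y x y =
     ((1 + real t) * y - (\<Sum>i\<in>{1..t}. q i) * x)\<^sup>2 + det_reg q t * x\<^sup>2"
    unfolding adj_form_def det_reg_def by (simp add: algebra_simps power2_eq_square)
  also have "\<dots> \<ge> 0" using assms by simp
  finally show ?thesis by (simp add: zero_le_mult_iff)
qed

lemma det_reg_ge_1: "det_reg q t \<ge> 1"
proof (induction t)
  case 0
  then show ?case by (simp add: det_reg_def)
next
  case (Suc t)
  then show ?case using adj_form_nonneg_aux[of q t 1 "q (Suc t)"] by (simp add: det_reg_Suc)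
qed

lemma det_reg_pos: "det_reg q t > 0"
  using det_reg_ge_1[of q t] by linarith

lemma adj_form_nonneg: "adj_form q t x y x y \<ge> 0"
  using adj_form_nonneg_aux det_reg_pos less_imp_le by blast

text \<open>Lagrange's identity for the form of adj(V): the squared cross product carries the factor
  det adj(V), which is det V in dimension two. Dropping either term on the right gives
  Cauchy-Schwarz or the cross product bound.\<close>

lemma adj_form_Lagrange:
  "adj_form q t x y x y * adj_form q t x' y' x' y'
     = (adj_form q t x y x' y')\<^sup>2 + det_reg q t * (x * y' - y * x')\<^sup>2"
  unfolding adj_form_def det_reg_def by (simp add: algebra_simps power2_eq_square)

lemma det_reg_cross_le:
  "det_reg q t * (x * y' - y * x')\<^sup>2 \<le> adj_form q t x y x y * adj_form q t x' y' x' y'"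
  by (simp add: adj_form_Lagrange)

lemma adj_form_Cauchy_Schwarz:
  "(adj_form q t x y x' y')\<^sup>2 \<le> adj_form q t x y x y * adj_form q t x' y' x' y'"
  using det_reg_pos[of q t] by (simp add: adj_form_Lagrange)

lemma self_norm_nonneg: "self_norm q e t \<ge> 0"
  unfolding self_norm_def using adj_form_nonneg det_reg_pos by (simp add: less_imp_le)

text \<open>Cauchy-Schwarz between the dual norms of V and its inverse. The first factor is g^T V g
  for g = (u, v); its part \<open>u^2 + v^2\<close> comes from the identity in V = I + P_t.\<close>

lemma self_norm_dual:
  "(u * (\<Sum>i\<in>{1..t}. e i) + v * (\<Sum>i\<in>{1..t}. e i * q i))\<^sup>2
     \<le> (u\<^sup>2 + v\<^sup>2 + (\<Sum>i\<in>{1..t}. (u + v * q i)\<^sup>2)) * self_norm q e t"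
proof -
  define s1 s2 z w where "s1 = (\<Sum>i\<in>{1..t}. q i)" and "s2 = (\<Sum>i\<in>{1..t}. (q i)\<^sup>2)"
    and "z = (\<Sum>i\<in>{1..t}. e i)" and "w = (\<Sum>i\<in>{1..t}. e i * q i)"
  have form: "u\<^sup>2 + v\<^sup>2 + (\<Sum>i\<in>{1..t}. (u + v * q i)\<^sup>2)
      = (1 + real t) * u\<^sup>2 + 2 * s1 * u * v + (1 + s2) * v\<^sup>2"
    unfolding s1_def s2_def
    by (simp add: power2_sum power_mult_distrib sum.distrib sum_distrib_left sum_distrib_right algebra_simps)
  have D: "det_reg q t = (1 + real t) * (1 + s2) - s1\<^sup>2"
    and Aq: "adj_form q t z w z w = (1 + s2) * z * z - s1 * (z * w + w * z) + (1 + real t) * w * w"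
    by (simp_all add: det_reg_def adj_form_def s1_def s2_def)
  \<comment> \<open>After multiplication by det V, the deficit in Cauchy-Schwarz is the squared
    cross product of V(u, v) with (z, w).\<close>
  have "((1 + real t) * u\<^sup>2 + 2 * s1 * u * v + (1 + s2) * v\<^sup>2) * adj_form q t z w z w
      - det_reg q t * (u * z + v * w)\<^sup>2
     = (((1 + real t) * u + s1 * v) * w - (s1 * u + (1 + s2) * v) * z)\<^sup>2"
    unfolding D Aq by (simp add: algebra_simps power2_eq_square)
  then have "det_reg q t * (u * z + v * w)\<^sup>2
      \<le> ((1 + real t) * u\<^sup>2 + 2 * s1 * u * v + (1 + s2) * v\<^sup>2) * adj_form q t z w z w"
    by (smt (verit) zero_le_power2)
  then show ?thesis
    unfolding form self_norm_def z_def[symmetric] w_def[symmetric]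
    using det_reg_pos[of q t] by (simp add: field_simps)
qed

text \<open>The Sherman--Morrison step; the coefficient of \<open>(e (Suc t))\<^sup>2\<close> is
  \<open>x\<^sup>T V\<^sup>-\<^sup>1 x\<close> for the new regressor \<open>x\<close>, written so that it telescopes through \<open>ln det V\<close>.\<close>

lemma self_norm_Suc:
  "self_norm q e (Suc t) \<le> self_norm q e t
     + 2 * (e (Suc t) * (adj_form q t 1 (q (Suc t)) (\<Sum>i\<in>{1..t}. e i) (\<Sum>i\<in>{1..t}. e i * q i)
              / det_reg q (Suc t)))
     + (e (Suc t))\<^sup>2 * (1 - det_reg q t / det_reg q (Suc t))"
proof -
  define z w n x where "z = (\<Sum>i\<in>{1..t}. e i)" and "w = (\<Sum>i\<in>{1..t}. e i * q i)"
    and "n = e (Suc t)" and "x = q (Suc t)"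
  define D where "D = det_reg q t"
  define D' where "D' = det_reg q (Suc t)"
  define A where "A = adj_form q t"
  have pos: "D > 0" "D' > 0" by (auto simp: D_def D'_def det_reg_pos)
  have D': "D' = D + A 1 x 1 x" unfolding D'_def D_def A_def x_def by (rule det_reg_Suc)
  have "adj_form q (Suc t) (z + n) (w + n * x) (z + n) (w + n * x)
      = A (z + n) (w + n * x) (z + n) (w + n * x) + (z * x - w)\<^sup>2"
    unfolding adj_form_Suc A_def x_def by (simp add: algebra_simps power2_eq_square)
  also have "A (z + n) (w + n * x) (z + n) (w + n * x)
      = A z w z w + 2 * n * A 1 x z w + n\<^sup>2 * A 1 x 1 x"
    unfolding A_def adj_form_def by (simp add: algebra_simps power2_eq_square)
  finally have e: "self_norm q e (Suc t)
      = (A z w z w + (z * x - w)\<^sup>2) / D' + 2 * (n * (A 1 x z w / D')) + n\<^sup>2 * (A 1 x 1 x / D')"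
    unfolding self_norm_def D'_def[symmetric]
    by (simp add: z_def w_def n_def x_def add_divide_distrib algebra_simps)
  \<comment> \<open>The extra square produced by the updated adjugate is outweighed by the growth of
    the determinant, so the first quotient does not exceed the old value of the form.\<close>
  have "D * (z * x - w)\<^sup>2 \<le> A z w z w * A 1 x 1 x"
    using det_reg_cross_le[of q t z x w 1] by (simp add: D_def A_def)
  then have "(A z w z w + (z * x - w)\<^sup>2) * D \<le> A z w z w * D'"
    unfolding D' by (simp add: algebra_simps)
  then have "(A z w z w + (z * x - w)\<^sup>2) / D' \<le> A z w z w / D"
    using pos by (simp add: divide_simps)
  moreover have "A 1 x 1 x / D' = 1 - D / D'"
    using pos D' by (simp add: field_simps)
  ultimately show ?thesis
    unfolding e by (simp add: self_norm_def z_def w_def n_def x_def D_def D'_def A_def)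
qed

text \<open>Apply ln s <= s - 1 to the ratio of consecutive determinants. The coefficients of the
  squared errors are thus dominated by increments of ln det V, which telescope.\<close>

lemma det_reg_ratio_le:
  "1 - det_reg q t / det_reg q (Suc t) \<le> ln (det_reg q (Suc t)) - ln (det_reg q t)"
proof -
  have "ln (det_reg q t / det_reg q (Suc t)) \<le> det_reg q t / det_reg q (Suc t) - 1"
    using det_reg_pos[of q t] det_reg_pos[of q "Suc t"] by (intro ln_le_minus_one) simp
  then show ?thesis
    using det_reg_pos[of q t] det_reg_pos[of q "Suc t"] by (simp add: ln_div)
qed

lemma det_reg_ratio_bounds:
  "0 \<le> 1 - det_reg q t / det_reg q (Suc t)" "1 - det_reg q t / det_reg q (Suc t) \<le> 1"
  using det_reg_pos[of q t] det_reg_pos[of q "Suc t"] adj_form_nonneg[of q t 1 "q (Suc t)"]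
  by (auto simp: det_reg_Suc)

lemma det_reg_le:
  assumes "\<And>i. 1 \<le> i \<Longrightarrow> i \<le> t \<Longrightarrow> \<bar>q i\<bar> \<le> R"
  shows "det_reg q t \<le> (1 + real t) * (1 + real t * R\<^sup>2)"
proof -
  have "(\<Sum>i\<in>{1..t}. (q i)\<^sup>2) \<le> (\<Sum>i\<in>{1..t}. R\<^sup>2)"
    using assms by (intro sum_mono) (metis abs_ge_zero atLeastAtMost_iff power2_abs power_mono)
  then have "(1 + real t) * (1 + (\<Sum>i\<in>{1..t}. (q i)\<^sup>2)) \<le> (1 + real t) * (1 + real t * R\<^sup>2)"
    by (intro mult_left_mono) auto
  then show ?thesis unfolding det_reg_def by (smt (verit) zero_le_power2)
qed

text \<open>The coefficient of the new error in the linear term of \<open>self_norm_Suc\<close> is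
  controlled by the current form, which will make the martingale term integrable. Cauchy-Schwarz for
  the adjugate form reduces the claim to D * A(x, x) <= (D + A(x, x))^2.\<close>

lemma self_norm_cross_le:
  "(adj_form q t 1 (q (Suc t)) (\<Sum>i\<in>{1..t}. e i) (\<Sum>i\<in>{1..t}. e i * q i) / det_reg q (Suc t))\<^sup>2
     \<le> self_norm q e t"
proof -
  define z w x where "z = (\<Sum>i\<in>{1..t}. e i)" and "w = (\<Sum>i\<in>{1..t}. e i * q i)" and "x = q (Suc t)"
  define D where "D = det_reg q t"
  define D' where "D' = det_reg q (Suc t)"
  define A where "A = adj_form q t"
  have D': "D' = D + A 1 x 1 x" unfolding D'_def D_def A_def x_def by (rule det_reg_Suc)
  have pos: "D > 0" "A 1 x 1 x \<ge> 0" "A z w z w \<ge> 0"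
    by (auto simp: D_def A_def det_reg_pos adj_form_nonneg)
  then have pos': "D' > 0" using D' by simp
  have "D * A 1 x 1 x \<le> D'\<^sup>2"
    unfolding D' power2_eq_square using pos by (intro mult_mono) auto
  then have "D * (A 1 x 1 x * A z w z w) \<le> D'\<^sup>2 * A z w z w"
    using mult_right_mono[OF _ pos(3), of "D * A 1 x 1 x" "D'\<^sup>2"] by (simp add: mult.assoc)
  moreover have "D * (A 1 x z w)\<^sup>2 \<le> D * (A 1 x 1 x * A z w z w)"
    using adj_form_Cauchy_Schwarz[of q t 1 x z w] pos by (intro mult_left_mono) (auto simp: A_def)
  ultimately have "D * (A 1 x z w)\<^sup>2 \<le> D'\<^sup>2 * A z w z w" by linarith
  then have "(A 1 x z w)\<^sup>2 / D'\<^sup>2 \<le> A z w z w / D"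
    using pos(1) pos' by (simp add: divide_simps mult.commute)
  then show ?thesis
    unfolding self_norm_def z_def w_def x_def D_def D'_def A_def by (simp add: power_divide)
qed

section \<open>Moments of the errors and of the self-normalised form\<close>

lemma A1_square_integrable:
  assumes "prob_space M" "A1 M F \<eta>" "i \<ge> 1" "\<eta> i \<in> borel_measurable M"
  shows "integrable M (\<lambda>\<omega>. (\<eta> i \<omega>)\<^sup>2)"
proof -
  interpret prob_space M by fact
  have [measurable]: "\<eta> i \<in> borel_measurable M" by fact
  obtain \<gamma> B where g: "\<gamma> > 2" "(\<integral>\<^sup>+\<omega>. ennreal (\<bar>\<eta> i \<omega>\<bar> powr \<gamma>) \<partial>M) \<le> ennreal B"
    using assms(2,3) unfolding A1_def by blast
  have "integrable M (\<lambda>\<omega>. \<bar>\<eta> i \<omega>\<bar> powr \<gamma>)"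
    using g(2) by (intro integrableI_bounded) (auto simp: order.strict_trans1[OF _ ennreal_less_top])
  then have "integrable M (\<lambda>\<omega>. 1 + \<bar>\<eta> i \<omega>\<bar> powr \<gamma>)" by simp
  then show ?thesis
  proof (rule Bochner_Integration.integrable_bound)
    show "AE \<omega> in M. norm ((\<eta> i \<omega>)\<^sup>2) \<le> norm (1 + \<bar>\<eta> i \<omega>\<bar> powr \<gamma>)"
    proof (intro AE_I2)
      fix \<omega>
      have "\<bar>\<eta> i \<omega>\<bar> ^ 2 \<le> 1 + \<bar>\<eta> i \<omega>\<bar> powr \<gamma>"
      proof (cases "\<bar>\<eta> i \<omega>\<bar> \<le> 1")
        case True
        then have "\<bar>\<eta> i \<omega>\<bar> ^ 2 \<le> 1" by (intro power_le_one) auto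
        then show ?thesis by (smt (verit) powr_ge_zero)
      next
        case False
        then have "\<bar>\<eta> i \<omega>\<bar> powr 2 \<le> \<bar>\<eta> i \<omega>\<bar> powr \<gamma>" using g by (intro powr_mono) auto
        moreover have "\<bar>\<eta> i \<omega>\<bar> powr 2 = \<bar>\<eta> i \<omega>\<bar> ^ 2" using False by (simp add: powr_numeral)
        ultimately show ?thesis by linarith
      qed
      then show "norm ((\<eta> i \<omega>)\<^sup>2) \<le> norm (1 + \<bar>\<eta> i \<omega>\<bar> powr \<gamma>)" by simp
    qed
  qed simp
qed

text \<open>Take expectations in \<open>self_norm_Suc\<close>. The linear term has mean zero because
  its coefficient is known one step earlier; conditioning bounds the quadratic term by \<sigma>
  times the expected increment of ln det V. The sum telescopes, and bounded prices bound ln det V by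
  a deterministic logarithm.\<close>

lemma expectation_self_norm_le:
  fixes p \<eta> :: "nat \<Rightarrow> 'a \<Rightarrow> real"
  assumes M: "prob_space M"
    and sub: "\<And>i. subalgebra M (F i)" and mono: "\<And>i j. i \<le> j \<Longrightarrow> subalgebra (F j) (F i)"
    and p: "\<And>t. t \<ge> 1 \<Longrightarrow> p t \<in> borel_measurable (F (t - 1))"
    and R: "\<And>t \<omega>. t \<ge> 1 \<Longrightarrow> \<omega> \<in> space M \<Longrightarrow> \<bar>p t \<omega>\<bar> \<le> R"
    and mds: "mds M F \<eta>" and A1: "A1 M F \<eta>"
  shows "\<exists>C\<ge>0. \<forall>t. integrable M (\<lambda>\<omega>. self_norm (\<lambda>i. p i \<omega>) (\<lambda>i. \<eta> i \<omega>) t) \<and>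
    (\<integral>\<omega>. self_norm (\<lambda>i. p i \<omega>) (\<lambda>i. \<eta> i \<omega>) t \<partial>M) \<le> C * ln ((1 + real t) * (1 + real t * R\<^sup>2))"
proof -
  interpret prob_space M by fact
  obtain \<sigma>0 where \<sigma>0: "\<And>i. i \<ge> 1 \<Longrightarrow> AE \<omega> in M. real_cond_exp M (F (i - 1)) (\<lambda>\<omega>. (\<eta> i \<omega>)\<^sup>2) \<omega> \<le> \<sigma>0"
    using A1 unfolding A1_def by blast
  \<comment> \<open>Truncated at 0 so that inequalities may be multiplied by it; \<open>A1\<close>
    records no sign for its variance bound.\<close>
  define \<sigma> where "\<sigma> = max \<sigma>0 0"
  define Q where "Q t \<omega> = self_norm (\<lambda>i. p i \<omega>) (\<lambda>i. \<eta> i \<omega>) t" for t \<omega>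
  define D where "D t \<omega> = det_reg (\<lambda>i. p i \<omega>) t" for t \<omega>
  define G where "G t \<omega> = adj_form (\<lambda>i. p i \<omega>) t 1 (p (Suc t) \<omega>) (\<Sum>i\<in>{1..t}. \<eta> i \<omega>)
     (\<Sum>i\<in>{1..t}. \<eta> i \<omega> * p i \<omega>) / D (Suc t) \<omega>" for t \<omega>
  define H where "H t \<omega> = 1 - D t \<omega> / D (Suc t) \<omega>" for t \<omega>
  have FM: "f \<in> borel_measurable M" if "f \<in> borel_measurable (F i)" for f :: "'a \<Rightarrow> real" and i
    using measurable_from_subalg[OF sub that] .
  have \<eta>F: "\<eta> i \<in> borel_measurable (F t)" if "1 \<le> i" "i \<le> t" for i t
    using mds that measurable_from_subalg[OF mono[OF that(2)]] unfolding mds_def by blast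
  have pF: "p i \<in> borel_measurable (F t)" if "1 \<le> i" "i \<le> Suc t" for i t
    by (rule measurable_from_subalg[OF mono p[OF that(1)]]) (use that in simp)
  \<comment> \<open>Prices are predictable, so the determinant of index \<open>Suc n\<close> is
    already measurable at time \<open>n\<close>. This shift is what makes \<open>G t\<close> and
    \<open>H t\<close> measurable with respect to \<open>F t\<close>.\<close>
  have DF: "D t \<in> borel_measurable (F n)" if "t \<le> Suc n" for t n
    unfolding D_def det_reg_def using that
    by (intro borel_measurable_diff borel_measurable_times borel_measurable_add borel_measurable_sum
        borel_measurable_power measurable_const pF) auto
  have GF: "G t \<in> borel_measurable (F t)" for t
    unfolding G_def adj_form_def
    by (intro borel_measurable_diff borel_measurable_times borel_measurable_add borel_measurable_sum
        borel_measurable_divide borel_measurable_power measurable_const pF \<eta>F DF) auto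
  have HF: "H t \<in> borel_measurable (F t)" for t
    unfolding H_def by (intro borel_measurable_diff borel_measurable_divide measurable_const DF) auto
  have QF: "Q t \<in> borel_measurable (F t)" for t
    unfolding Q_def self_norm_def D_def[symmetric] adj_form_def
    by (intro borel_measurable_diff borel_measurable_times borel_measurable_add borel_measurable_sum
        borel_measurable_divide borel_measurable_power measurable_const pF \<eta>F DF) auto
  have [measurable]: "G t \<in> borel_measurable M" "H t \<in> borel_measurable M" "Q t \<in> borel_measurable M"
    "D t \<in> borel_measurable M" for t
    using FM[OF GF] FM[OF HF] FM[OF QF] FM[OF DF[of t t]] by auto
  have \<eta>M: "\<eta> (Suc t) \<in> borel_measurable M" for t using FM[OF \<eta>F[of "Suc t"]] by auto
  note [measurable] = \<eta>M
  have sq: "integrable M (\<lambda>\<omega>. (\<eta> (Suc t) \<omega>)\<^sup>2)" for t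
    by (rule A1_square_integrable[OF M A1]) (auto simp: \<eta>M)
  have Dbd: "1 \<le> D t \<omega>" "ln (D t \<omega>) \<le> ln ((1 + real t) * (1 + real t * R\<^sup>2))"
    if "\<omega> \<in> space M" for t \<omega>
  proof -
    show 1: "1 \<le> D t \<omega>" unfolding D_def by (rule det_reg_ge_1)
    show "ln (D t \<omega>) \<le> ln ((1 + real t) * (1 + real t * R\<^sup>2))"
      using 1 det_reg_le[of t "\<lambda>i. p i \<omega>" R] R that by (intro ln_mono) (auto simp: D_def)
  qed
  have lnD: "integrable M (\<lambda>\<omega>. ln (D t \<omega>))" for t
    using Dbd by (intro integrable_const_bound[where B="ln ((1 + real t) * (1 + real t * R\<^sup>2))"] AE_I2) auto
  have Hb: "0 \<le> H t \<omega>" "H t \<omega> \<le> 1" "H t \<omega> \<le> ln (D (Suc t) \<omega>) - ln (D t \<omega>)" for t \<omega>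
    unfolding H_def D_def by (rule det_reg_ratio_bounds det_reg_ratio_le)+
  have Hi: "integrable M (H t)" for t
    using Hb by (intro integrable_const_bound[where B=1] AE_I2) auto
  \<comment> \<open>Integrability travels with the bound, since \<open>Q (Suc t)\<close> is
    dominated by an expression containing \<open>Q t\<close>. The random ln det V is kept on the
    right so that the induction telescopes.\<close>
  have main: "integrable M (Q t) \<and> (\<integral>\<omega>. Q t \<omega> \<partial>M) \<le> \<sigma> * (\<integral>\<omega>. ln (D t \<omega>) \<partial>M)" for t
  proof (induction t)
    case 0
    then show ?case by (simp add: Q_def D_def self_norm_def adj_form_def det_reg_def)
  next
    case (Suc t)
    interpret S: finite_measure_subalgebra M "F t" by unfold_locales (rule sub)
    have G2: "(G t \<omega>)\<^sup>2 \<le> Q t \<omega>" for \<omega>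
      unfolding G_def Q_def D_def by (rule self_norm_cross_le)
    have eG: "integrable M (\<lambda>\<omega>. G t \<omega> * \<eta> (Suc t) \<omega>)"
    proof (rule Bochner_Integration.integrable_bound)
      show "integrable M (\<lambda>\<omega>. Q t \<omega> + (\<eta> (Suc t) \<omega>)\<^sup>2)" using Suc sq by simp
      show "AE \<omega> in M. norm (G t \<omega> * \<eta> (Suc t) \<omega>) \<le> norm (Q t \<omega> + (\<eta> (Suc t) \<omega>)\<^sup>2)"
      proof (intro AE_I2)
        fix \<omega>
        have "2 * \<bar>G t \<omega>\<bar> * \<bar>\<eta> (Suc t) \<omega>\<bar> \<le> (G t \<omega>)\<^sup>2 + (\<eta> (Suc t) \<omega>)\<^sup>2"
          using sum_squares_bound[of "\<bar>G t \<omega>\<bar>" "\<bar>\<eta> (Suc t) \<omega>\<bar>"] by simp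
        then have "\<bar>G t \<omega> * \<eta> (Suc t) \<omega>\<bar> \<le> (G t \<omega>)\<^sup>2 + (\<eta> (Suc t) \<omega>)\<^sup>2"
          using abs_ge_zero[of "G t \<omega> * \<eta> (Suc t) \<omega>"] by (simp only: abs_mult mult.assoc)
        then show "norm (G t \<omega> * \<eta> (Suc t) \<omega>) \<le> norm (Q t \<omega> + (\<eta> (Suc t) \<omega>)\<^sup>2)"
          using G2[of \<omega>] by simp
      qed
    qed measurable
    have eG0: "(\<integral>\<omega>. G t \<omega> * \<eta> (Suc t) \<omega> \<partial>M) = 0"
    proof -
      have "(\<integral>\<omega>. G t \<omega> * \<eta> (Suc t) \<omega> \<partial>M)
          = (\<integral>\<omega>. G t \<omega> * real_cond_exp M (F t) (\<eta> (Suc t)) \<omega> \<partial>M)"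
        using S.real_cond_exp_intg(2)[OF eG GF \<eta>M] by simp
      also have "\<dots> = (\<integral>\<omega>. 0 \<partial>M)"
      proof (rule integral_cong_AE)
        have "AE \<omega> in M. real_cond_exp M (F t) (\<eta> (Suc t)) \<omega> = 0"
          using mds[unfolded mds_def, rule_format, of "Suc t"] by simp
        then show "AE \<omega> in M. G t \<omega> * real_cond_exp M (F t) (\<eta> (Suc t)) \<omega> = 0" by eventually_elim simp
      qed auto
      finally show ?thesis by simp
    qed
    have e2H: "integrable M (\<lambda>\<omega>. H t \<omega> * (\<eta> (Suc t) \<omega>)\<^sup>2)"
    proof (rule Bochner_Integration.integrable_bound[OF sq[of t]])
      show "AE \<omega> in M. norm (H t \<omega> * (\<eta> (Suc t) \<omega>)\<^sup>2) \<le> norm ((\<eta> (Suc t) \<omega>)\<^sup>2)"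
        using Hb[of t] by (intro AE_I2) (auto simp: abs_mult intro!: mult_left_le_one_le)
    qed measurable
    \<comment> \<open>Only the conditional second moment of the error is bounded, so the square is
      first replaced by its conditional expectation; \<open>H t\<close> is measurable at time
      \<open>t\<close> and may stay outside.\<close>
    have "(\<integral>\<omega>. H t \<omega> * (\<eta> (Suc t) \<omega>)\<^sup>2 \<partial>M)
        = (\<integral>\<omega>. H t \<omega> * real_cond_exp M (F t) (\<lambda>\<omega>. (\<eta> (Suc t) \<omega>)\<^sup>2) \<omega> \<partial>M)"
      using S.real_cond_exp_intg(2)[OF e2H HF] by simp
    also have "\<dots> \<le> (\<integral>\<omega>. \<sigma> * (ln (D (Suc t) \<omega>) - ln (D t \<omega>)) \<partial>M)"
    proof (rule integral_mono_AE)
      show "integrable M (\<lambda>\<omega>. H t \<omega> * real_cond_exp M (F t) (\<lambda>\<omega>. (\<eta> (Suc t) \<omega>)\<^sup>2) \<omega>)"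
        by (rule S.real_cond_exp_intg(1)[OF e2H HF]) simp
      have "AE \<omega> in M. real_cond_exp M (F t) (\<lambda>\<omega>. (\<eta> (Suc t) \<omega>)\<^sup>2) \<omega> \<le> \<sigma>0"
        using \<sigma>0[of "Suc t"] by simp
      then show "AE \<omega> in M. H t \<omega> * real_cond_exp M (F t) (\<lambda>\<omega>. (\<eta> (Suc t) \<omega>)\<^sup>2) \<omega>
          \<le> \<sigma> * (ln (D (Suc t) \<omega>) - ln (D t \<omega>))"
      proof eventually_elim
        case (elim \<omega>)
        have "H t \<omega> * real_cond_exp M (F t) (\<lambda>\<omega>. (\<eta> (Suc t) \<omega>)\<^sup>2) \<omega> \<le> H t \<omega> * \<sigma>"
          using elim Hb[of t \<omega>] by (intro mult_left_mono) (auto simp: \<sigma>_def)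
        also have "\<dots> \<le> (ln (D (Suc t) \<omega>) - ln (D t \<omega>)) * \<sigma>"
          using Hb[of t \<omega>] by (intro mult_right_mono) (auto simp: \<sigma>_def)
        finally show ?case by (simp add: mult.commute)
      qed
    qed (use lnD in simp)
    finally have e2Hle: "(\<integral>\<omega>. H t \<omega> * (\<eta> (Suc t) \<omega>)\<^sup>2 \<partial>M)
        \<le> \<sigma> * (\<integral>\<omega>. ln (D (Suc t) \<omega>) \<partial>M) - \<sigma> * (\<integral>\<omega>. ln (D t \<omega>) \<partial>M)"
      using lnD by (simp add: algebra_simps)
    let ?B = "\<lambda>\<omega>. Q t \<omega> + 2 * (G t \<omega> * \<eta> (Suc t) \<omega>) + H t \<omega> * (\<eta> (Suc t) \<omega>)\<^sup>2"
    have Bi: "integrable M ?B" using Suc eG e2H by simp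
    have step: "Q (Suc t) \<omega> \<le> ?B \<omega>" for \<omega>
      using self_norm_Suc[of "\<lambda>i. p i \<omega>" "\<lambda>i. \<eta> i \<omega>" t]
      unfolding Q_def G_def H_def D_def by (simp add: mult.commute)
    have Q0: "0 \<le> Q t \<omega>" for t \<omega> unfolding Q_def by (rule self_norm_nonneg)
    have Qi: "integrable M (Q (Suc t))"
    proof (rule Bochner_Integration.integrable_bound[OF Bi])
      show "AE \<omega> in M. norm (Q (Suc t) \<omega>) \<le> norm (?B \<omega>)"
        using order_trans[OF Q0 step] step Q0 by (intro AE_I2) simp
    qed measurable
    have "(\<integral>\<omega>. Q (Suc t) \<omega> \<partial>M) \<le> (\<integral>\<omega>. ?B \<omega> \<partial>M)"
      using Qi Bi step by (rule integral_mono)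
    also have "\<dots> = (\<integral>\<omega>. Q t \<omega> \<partial>M) + (\<integral>\<omega>. H t \<omega> * (\<eta> (Suc t) \<omega>)\<^sup>2 \<partial>M)"
      using Suc eG e2H eG0 by simp
    also have "\<dots> \<le> \<sigma> * (\<integral>\<omega>. ln (D (Suc t) \<omega>) \<partial>M)"
      using e2Hle Suc by linarith
    finally show ?case using Qi by simp
  qed
  show ?thesis
  proof (intro exI[of _ \<sigma>] conjI allI)
    show "0 \<le> \<sigma>" by (simp add: \<sigma>_def)
    fix t
    show "integrable M (\<lambda>\<omega>. self_norm (\<lambda>i. p i \<omega>) (\<lambda>i. \<eta> i \<omega>) t)"
      using main[of t] by (simp add: Q_def[abs_def])
    have "(\<integral>\<omega>. ln (D t \<omega>) \<partial>M) \<le> (\<integral>\<omega>. ln ((1 + real t) * (1 + real t * R\<^sup>2)) \<partial>M)"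
      using lnD Dbd by (intro integral_mono) auto
    then have "(\<integral>\<omega>. ln (D t \<omega>) \<partial>M) \<le> ln ((1 + real t) * (1 + real t * R\<^sup>2))"
      by (simp add: prob_space)
    then have "\<sigma> * (\<integral>\<omega>. ln (D t \<omega>) \<partial>M) \<le> \<sigma> * ln ((1 + real t) * (1 + real t * R\<^sup>2))"
      by (intro mult_left_mono) (auto simp: \<sigma>_def)
    then show "(\<integral>\<omega>. self_norm (\<lambda>i. p i \<omega>) (\<lambda>i. \<eta> i \<omega>) t \<partial>M)
       \<le> \<sigma> * ln ((1 + real t) * (1 + real t * R\<^sup>2))"
      using main[of t] by (simp add: Q_def[abs_def])
  qed
qed

section \<open>Quasi-score equations\<close>

text \<open>The quasi-score of one of the two regressions. It takes values in pairs so that it lies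
  in the same Euclidean space as either half of \<open>param\<close>, as Brouwer's theorem and inner
  products with parameter increments require.\<close>

definition score :: "(real \<Rightarrow> real) \<Rightarrow> (nat \<Rightarrow> real) \<Rightarrow> (nat \<Rightarrow> real) \<Rightarrow> nat \<Rightarrow> real \<times> real \<Rightarrow> real \<times> real" where
  "score h q y t \<alpha> = ((\<Sum>i\<in>{1..t}. y i - h (fst \<alpha> + snd \<alpha> * q i)),
                       (\<Sum>i\<in>{1..t}. (y i - h (fst \<alpha> + snd \<alpha> * q i)) * q i))"

lemma pvec_vec2: "pvec x \<bullet> vec2 \<alpha> = fst \<alpha> + snd \<alpha> * x"
  by (simp add: pvec_def vec2_def inner_vec_def sum_2)

text \<open>The two halves of the parameter enter separate equations, so an MQLE exists exactly when
  each regression has a zero of its score.\<close>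

lemma is_MQLE_iff_score:
  "is_MQLE p d c h1 h2 t \<omega> \<beta> \<longleftrightarrow>
     score h1 (\<lambda>i. p i \<omega>) (\<lambda>i. d i \<omega>) t (fst \<beta>) = 0 \<and>
     score h2 (\<lambda>i. p i \<omega>) (\<lambda>i. ln (c i \<omega>)) t (snd \<beta>) = 0"
  unfolding is_MQLE_def score_def pvec_vec2
  by (auto simp: vec_eq_iff forall_2 sum_component pvec_def zero_prod_def)

lemma inner_score:
  "v \<bullet> score h q y t \<alpha> = (\<Sum>i\<in>{1..t}. (y i - h (fst \<alpha> + snd \<alpha> * q i)) * (fst v + snd v * q i))"
  by (simp add: score_def inner_prod_def sum_distrib_left flip: sum.distrib)
     (simp add: algebra_simps)

text \<open>The mean value theorem gives slope at least \<kappa> over the short step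
  \<open>\<theta> * w\<close>, which stays inside \<open>{-W..W}\<close>. The remaining stretch up
  to \<open>w\<close> only helps because \<open>h\<close> is increasing, so \<open>w\<close> may be
  arbitrarily long.\<close>

lemma slope_lower_bound:
  fixes h h' :: "real \<Rightarrow> real"
  assumes h: "\<And>x. (h has_real_derivative h' x) (at x)" and pos: "\<And>x. h' x > 0"
    and \<kappa>: "\<And>x. \<bar>x\<bar> \<le> W \<Longrightarrow> \<kappa> \<le> h' x"
    and \<theta>: "0 < \<theta>" "\<theta> \<le> 1" and W: "\<bar>s\<bar> + \<bar>\<theta> * w\<bar> \<le> W"
  shows "\<kappa> * (\<theta> * w)\<^sup>2 \<le> (h (s + w) - h s) * (\<theta> * w)"
proof -
  have mono: "h x \<le> h y" if "x \<le> y" for x y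
    using that h pos by (meson DERIV_nonneg_imp_nondecreasing less_imp_le)
  have lower: "\<kappa> * (y - x) \<le> h y - h x" if "x \<le> y" "\<bar>x\<bar> \<le> W" "\<bar>y\<bar> \<le> W" for x y
  proof (cases "x = y")
    case False
    then obtain z where z: "x < z" "z < y" "h y - h x = (y - x) * h' z"
      using MVT2[of x y h h'] h \<open>x \<le> y\<close> by force
    then show ?thesis
      using \<kappa>[of z] that by (auto simp: mult.commute[of \<kappa>] intro!: mult_left_mono)
  qed simp
  consider "w \<ge> 0" | "w < 0" by linarith
  then show ?thesis
  proof cases
    case 1
    have "\<kappa> * (\<theta> * w) \<le> h (s + \<theta> * w) - h s" 
    proof -
      have "0 \<le> \<theta> * w" using \<theta> 1 by simp
      then show ?thesis using lower[of s "s + \<theta> * w"] W by simp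
    qed
    also have "\<dots> \<le> h (s + w) - h s"
      using mono[of "s + \<theta> * w" "s + w"] \<theta> 1 by (simp add: mult_left_le_one_le)
    finally have "\<kappa> * (\<theta> * w) * (\<theta> * w) \<le> (h (s + w) - h s) * (\<theta> * w)"
      using \<theta> 1 by (intro mult_right_mono) auto
    then show ?thesis by (simp add: power2_eq_square algebra_simps)
  next
    case 2
    have le: "\<theta> * w \<le> 0" using \<theta> 2 by (simp add: mult_le_0_iff)
    have "h (s + w) - h s \<le> h (s + \<theta> * w) - h s"
      using mono[of "s + w" "s + \<theta> * w"] \<theta> 2 mult_left_le_one_le[of "- w" \<theta>] by simp
    also have "\<dots> \<le> \<kappa> * (\<theta> * w)"
    proof -
      have "\<bar>s\<bar> \<le> W" "\<bar>s + \<theta> * w\<bar> \<le> W" using W by linarith+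
      then show ?thesis using lower[of "s + \<theta> * w" s] le by simp
    qed
    finally have "\<kappa> * (\<theta> * w) * (\<theta> * w) \<le> (h (s + w) - h s) * (\<theta> * w)"
      using le by (rule mult_right_mono_neg)
    then show ?thesis by (simp add: power2_eq_square algebra_simps)
  qed
qed

text \<open>Test the score at \<open>a + v\<close> against the shortened vector \<open>u\<close>.
  Its sign lets it be dropped, leaving \<kappa> S <= u . Z with S = u^T P_t u and Z the error
  vector. Duality turns this into (\<kappa> S)^2 <= (|u|^2 + S) Q, and one factor S cancels.
  \<open>W\<close> dominates all linear predictors at parameters within distance one of
  \<open>a\<close>; \<open>L0\<close> keeps the constant independent of \<open>t\<close>.\<close>

lemma score_direction_bound:
  fixes h h' :: "real \<Rightarrow> real" and v a :: "real \<times> real"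
  assumes h: "\<And>x. (h has_real_derivative h' x) (at x)" and pos: "\<And>x. h' x > 0"
    and \<kappa>: "\<kappa> > 0" "\<And>x. \<bar>x\<bar> \<le> W \<Longrightarrow> \<kappa> \<le> h' x"
    and q: "\<And>i. i \<in> {1..t} \<Longrightarrow> \<bar>q i\<bar> \<le> R"
    and W: "\<bar>fst a\<bar> + \<bar>snd a\<bar> * R + (1 + R) \<le> W"
    and L: "0 < L0" "L0 \<le> L" "\<And>x y. L * (x\<^sup>2 + y\<^sup>2) \<le> (\<Sum>i\<in>{1..t}. (x + y * q i)\<^sup>2)"
    and sgn: "0 \<le> v \<bullet> score h q y t (a + v)"
  shows "min 1 ((norm v)\<^sup>2) * L
    \<le> (1 + 1 / L0) / \<kappa>\<^sup>2 * self_norm q (\<lambda>i. y i - h (fst a + snd a * q i)) t"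
proof (cases "v = 0")
  case True
  then show ?thesis using L(1) by (simp add: self_norm_nonneg)
next
  case False
  define Q where "Q = self_norm q (\<lambda>i. y i - h (fst a + snd a * q i)) t"
  \<comment> \<open>Shortens \<open>v\<close> to length at most one, where the slope of the link is
    at least \<kappa>. The squared length of \<open>u\<close> is then the truncated quantity in the
    claim.\<close>
  define \<theta> where "\<theta> = min 1 (1 / norm v)"
  define u where "u = \<theta> *\<^sub>R v"
  define S where "S = (\<Sum>i\<in>{1..t}. (fst u + snd u * q i)\<^sup>2)"
  define s w where "s i = fst a + snd a * q i" and "w i = fst v + snd v * q i" for i
  have \<theta>: "0 < \<theta>" "\<theta> \<le> 1" using False by (auto simp: \<theta>_def)
  have nu: "norm u = min 1 (norm v)"
    using False by (auto simp: u_def \<theta>_def min_def field_simps)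
  have nu2: "(norm u)\<^sup>2 = min 1 ((norm v)\<^sup>2)"
    unfolding nu min_def using abs_square_less_1[of "norm v"] one_le_power[of "norm v" 2] by (auto simp: not_le)
  have nu': "(norm u)\<^sup>2 = (fst u)\<^sup>2 + (snd u)\<^sup>2" by (cases u) (simp add: norm_Pair)
  have nu0: "0 < (norm u)\<^sup>2" using False \<theta> by (simp add: u_def)
  have tw: "\<theta> * w i = fst u + snd u * q i" for i by (simp add: u_def w_def algebra_simps)
  have slope: "\<kappa> * (\<theta> * w i)\<^sup>2 \<le> (h (s i + w i) - h (s i)) * (\<theta> * w i)" if i: "i \<in> {1..t}" for i
  proof (rule slope_lower_bound[OF h pos \<kappa>(2) \<theta>])
    have uv: "\<bar>fst u\<bar> \<le> 1" "\<bar>snd u\<bar> \<le> 1"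
      using norm_fst_le[of "fst u" "snd u"] norm_snd_le[of "snd u" "fst u"] nu by auto
    have "\<bar>fst u + snd u * q i\<bar> \<le> \<bar>fst u\<bar> + \<bar>snd u\<bar> * \<bar>q i\<bar>"
      by (metis abs_mult abs_triangle_ineq)
    also have "\<dots> \<le> 1 + 1 * R" using uv q[OF i] by (intro add_mono mult_mono) auto
    finally have 1: "\<bar>\<theta> * w i\<bar> \<le> 1 + R" unfolding tw by simp
    have "\<bar>s i\<bar> \<le> \<bar>fst a\<bar> + \<bar>snd a\<bar> * \<bar>q i\<bar>"
      unfolding s_def by (metis abs_mult abs_triangle_ineq)
    also have "\<dots> \<le> \<bar>fst a\<bar> + \<bar>snd a\<bar> * R" using q[OF i] by (intro add_mono mult_mono) auto
    finally show "\<bar>s i\<bar> + \<bar>\<theta> * w i\<bar> \<le> W" using 1 W by linarith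
  qed
  have "\<kappa> * S \<le> (\<Sum>i\<in>{1..t}. (h (s i + w i) - h (s i)) * (\<theta> * w i))"
    unfolding S_def sum_distrib_left tw[symmetric] by (intro sum_mono slope)
  \<comment> \<open>An increment of \<open>h\<close> is the residual at \<open>a\<close> minus the
    residual at \<open>a + v\<close>; the latter residuals add up to the score tested against
    \<open>v\<close>.\<close>
  also have "\<dots> = (\<Sum>i\<in>{1..t}. (y i - h (s i)) * (\<theta> * w i)) - \<theta> * (v \<bullet> score h q y t (a + v))"
    by (simp add: inner_score s_def w_def sum_distrib_left flip: sum_subtractf) (simp add: algebra_simps)
  also have "\<dots> \<le> (\<Sum>i\<in>{1..t}. (y i - h (s i)) * (\<theta> * w i))" using sgn \<theta> by simp
  also have "\<dots> = fst u * (\<Sum>i\<in>{1..t}. y i - h (s i)) + snd u * (\<Sum>i\<in>{1..t}. (y i - h (s i)) * q i)"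
    unfolding tw by (simp add: sum_distrib_left flip: sum.distrib) (simp add: algebra_simps)
  finally have le: "\<kappa> * S \<le> \<dots>" .
  have S0: "L * (norm u)\<^sup>2 \<le> S" using L(3)[of "fst u" "snd u"] by (simp add: S_def nu')
  then have Spos: "0 < S" using L nu0 by (smt (verit) mult_pos_pos)
  have "(\<kappa> * S)\<^sup>2 \<le> (fst u * (\<Sum>i\<in>{1..t}. y i - h (s i)) + snd u * (\<Sum>i\<in>{1..t}. (y i - h (s i)) * q i))\<^sup>2"
    using le \<kappa>(1) Spos by (intro power_mono) auto
  also have "\<dots> \<le> ((norm u)\<^sup>2 + S) * Q"
    unfolding nu' S_def Q_def s_def by (rule self_norm_dual)
  \<comment> \<open>The contribution |u|^2 of the regularising identity is absorbed through |u|^2 L0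
    <= |u|^2 L <= S.\<close>
  also have "\<dots> \<le> (S / L0 + S) * Q"
  proof -
    have "(norm u)\<^sup>2 * L0 \<le> S" using S0 L(2) nu0 by (smt (verit) mult.commute mult_right_mono)
    then have "(norm u)\<^sup>2 \<le> S / L0" using L(1) by (simp add: field_simps)
    then show ?thesis by (intro mult_right_mono) (auto simp: Q_def self_norm_nonneg)
  qed
  finally have "S * (\<kappa>\<^sup>2 * S) \<le> S * ((1 + 1 / L0) * Q)"
    by (simp add: power2_eq_square algebra_simps)
  then have "\<kappa>\<^sup>2 * S \<le> (1 + 1 / L0) * Q" using Spos by simp
  then have "S \<le> (1 + 1 / L0) / \<kappa>\<^sup>2 * Q" using \<kappa>(1) by (simp add: field_simps)
  then show ?thesis using S0 unfolding nu2 Q_def by (simp add: mult.commute)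
qed

text \<open>Brouwer: the normalised score is a self-map of the unit ball, and its fixed point lies on
  the sphere.\<close>

lemma unsolvable_score_outward:
  fixes a :: "real \<times> real"
  assumes h: "\<And>x. (h has_real_derivative h' x) (at x)" and no: "\<And>\<alpha>. score h q y t \<alpha> \<noteq> 0"
  obtains v where "norm v = 1" "0 \<le> v \<bullet> score h q y t (a + v)"
proof -
  have ch: "continuous_on UNIV h"
    using h by (meson DERIV_isCont continuous_at_imp_continuous_on)
  have cS: "continuous_on (cball 0 1) (\<lambda>v. score h q y t (a + v))"
    unfolding score_def
    by (intro continuous_intros continuous_on_compose2[OF ch]) auto
  obtain v where v: "v \<in> cball 0 1" "sgn (score h q y t (a + v)) = v"
  proof (rule brouwer_ball[of 1 0 "\<lambda>v. sgn (score h q y t (a + v))"])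
    show "continuous_on (cball 0 1) (\<lambda>v. sgn (score h q y t (a + v)))"
      unfolding sgn_div_norm using cS no by (intro continuous_intros) auto
  qed (auto simp: norm_sgn)
  show ?thesis
  proof
    show "norm v = 1" using v(2) no by (metis norm_sgn)
    have "v \<bullet> score h q y t (a + v) = sgn (score h q y t (a + v)) \<bullet> score h q y t (a + v)"
      using v by simp
    then show "0 \<le> v \<bullet> score h q y t (a + v)" by (simp add: sgn_div_norm)
  qed
qed

text \<open>The constant depends only on \<open>L0\<close> and the minimum of \<open>h'\<close> on a
  compact interval, so it serves all horizons and data. At a zero \<alpha> of the score the
  direction \<open>\<alpha> - a\<close> meets the sign condition with equality; without zeros a unit
  direction meets it, and the truncation equals 1.\<close>

lemma score_error_bound:
  fixes h h' :: "real \<Rightarrow> real" and a :: "real \<times> real"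
  assumes h: "\<And>x. (h has_real_derivative h' x) (at x)" and pos: "\<And>x. h' x > 0"
    and cont: "continuous_on UNIV h'" and L0: "L0 > 0"
  shows "\<exists>C\<ge>0. \<forall>t q y L. (\<forall>i\<in>{1..t}. \<bar>q i\<bar> \<le> R) \<longrightarrow> L0 \<le> L \<longrightarrow>
     (\<forall>u v. L * (u\<^sup>2 + v\<^sup>2) \<le> (\<Sum>i\<in>{1..t}. (u + v * q i)\<^sup>2)) \<longrightarrow>
     (\<forall>\<alpha>. score h q y t \<alpha> = 0 \<longrightarrow>
        min 1 ((norm (\<alpha> - a))\<^sup>2) * L \<le> C * self_norm q (\<lambda>i. y i - h (fst a + snd a * q i)) t) \<and>
     ((\<forall>\<alpha>. score h q y t \<alpha> \<noteq> 0) \<longrightarrow>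
        L \<le> C * self_norm q (\<lambda>i. y i - h (fst a + snd a * q i)) t)"
proof -
  \<comment> \<open>The outer absolute value makes the interval \<open>{-W..W}\<close> nonempty
    whatever the sign of \<open>R\<close>.\<close>
  define W where "W = \<bar>\<bar>fst a\<bar> + \<bar>snd a\<bar> * R + (1 + R)\<bar>"
  have "\<exists>x\<in>{-W..W}. \<forall>y\<in>{-W..W}. h' x \<le> h' y"
    by (intro continuous_attains_inf continuous_on_subset[OF cont]) (auto simp: W_def)
  then obtain x where "\<forall>y\<in>{-W..W}. h' x \<le> h' y" by blast
  then have x: "h' x \<le> h' y" if "\<bar>y\<bar> \<le> W" for y
    using that by (auto simp: abs_le_iff)
  show ?thesis
  proof (intro exI[of _ "(1 + 1 / L0) / (h' x)\<^sup>2"] conjI allI impI)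
    show "0 \<le> (1 + 1 / L0) / (h' x)\<^sup>2" using L0 by simp
    fix t and q y :: "nat \<Rightarrow> real" and L :: real
    assume q: "\<forall>i\<in>{1..t}. \<bar>q i\<bar> \<le> R" and L: "L0 \<le> L"
      "\<forall>u v. L * (u\<^sup>2 + v\<^sup>2) \<le> (\<Sum>i\<in>{1..t}. (u + v * q i)\<^sup>2)"
    have bound: "min 1 ((norm v)\<^sup>2) * L
        \<le> (1 + 1 / L0) / (h' x)\<^sup>2 * self_norm q (\<lambda>i. y i - h (fst a + snd a * q i)) t"
      if "0 \<le> v \<bullet> score h q y t (a + v)" for v
      by (rule score_direction_bound[OF h pos pos x _ _ L0 L(1) _ that]) (use q L in \<open>auto simp: W_def\<close>)
    show "min 1 ((norm (\<alpha> - a))\<^sup>2) * L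
        \<le> (1 + 1 / L0) / (h' x)\<^sup>2 * self_norm q (\<lambda>i. y i - h (fst a + snd a * q i)) t"
      if "score h q y t \<alpha> = 0" for \<alpha>
      using bound[of "\<alpha> - a"] that by simp
    show "L \<le> (1 + 1 / L0) / (h' x)\<^sup>2 * self_norm q (\<lambda>i. y i - h (fst a + snd a * q i)) t"
      if unsolvable: "\<forall>\<alpha>. score h q y t \<alpha> \<noteq> 0"
    proof -
      obtain v where "norm v = 1" "0 \<le> v \<bullet> score h q y t (a + v)"
        by (rule unsolvable_score_outward[of h h' q y t a]) (use h unsolvable in blast)+
      then show ?thesis using bound[of v] by simp
    qed
  qed
qed

section \<open>The smallest eigenvalue as a bound on the quadratic form\<close>

text \<open>\<open>lambda_min\<close> is a \<open>Min\<close>, so finiteness of the set of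
  eigenvalues is needed; it follows from the characteristic polynomial. The smaller root
  \<open>m\<close> is shown to be an eigenvalue, hence bounds \<open>lambda_min A\<close> from
  above, and the form minus m times the squared length is nonnegative because its discriminant
  vanishes.\<close>

lemma quadratic_form_ge_lambda_min:
  fixes A :: "real^2^2"
  assumes sym: "A $ 1 $ 2 = A $ 2 $ 1"
  shows "lambda_min A * (x\<^sup>2 + y\<^sup>2) \<le> A $ 1 $ 1 * x\<^sup>2 + 2 * A $ 1 $ 2 * x * y + A $ 2 $ 2 * y\<^sup>2"
proof -
  define a b d where "a = A $ 1 $ 1" and "b = A $ 1 $ 2" and "d = A $ 2 $ 2"
  define E where "E = {l. \<exists>v::real^2. v \<noteq> 0 \<and> A *v v = l *\<^sub>R v}"
  have Av: "A *v v = l *\<^sub>R v \<longleftrightarrow> a * v $ 1 + b * v $ 2 = l * v $ 1 \<and> b * v $ 1 + d * v $ 2 = l * v $ 2"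
    for v l
    using sym by (simp add: vec_eq_iff forall_2 matrix_vector_mult_def sum_2 a_def b_def d_def)
  have root: "(a - l) * (d - l) = b\<^sup>2" if "l \<in> E" for l
  proof -
    obtain v :: "real^2" where v: "v \<noteq> 0" "A *v v = l *\<^sub>R v" using \<open>l \<in> E\<close> by (auto simp: E_def)
    have e: "(a - l) * v $ 1 = - (b * v $ 2)" "(d - l) * v $ 2 = - (b * v $ 1)"
      using v(2) unfolding Av by (auto simp: algebra_simps)
    have "((a - l) * (d - l) - b\<^sup>2) * v $ 1 = (d - l) * ((a - l) * v $ 1) - b * (b * v $ 1)"
      by (simp add: algebra_simps power2_eq_square)
    also have "\<dots> = - (b * ((d - l) * v $ 2)) - b * (b * v $ 1)" unfolding e(1) by (simp add: algebra_simps)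
    also have "\<dots> = 0" unfolding e(2) by simp
    finally have 1: "((a - l) * (d - l) - b\<^sup>2) * v $ 1 = 0" .
    have "((a - l) * (d - l) - b\<^sup>2) * v $ 2 = (a - l) * ((d - l) * v $ 2) - b * (b * v $ 2)"
      by (simp add: algebra_simps power2_eq_square)
    also have "\<dots> = - (b * ((a - l) * v $ 1)) - b * (b * v $ 2)" unfolding e(2) by (simp add: algebra_simps)
    also have "\<dots> = 0" unfolding e(1) by simp
    finally have 2: "((a - l) * (d - l) - b\<^sup>2) * v $ 2 = 0" .
    have "v $ 1 \<noteq> 0 \<or> v $ 2 \<noteq> 0" using v(1) by (auto simp: vec_eq_iff forall_2)
    then show ?thesis using 1 2 by auto
  qed
  define p where "p = [:a * d - b\<^sup>2, - (a + d), 1:]"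
  have "E \<subseteq> {l. poly p l = 0}"
    using root by (auto simp: p_def algebra_simps)
  moreover have "p \<noteq> 0" by (simp add: p_def)
  ultimately have fin: "finite E" using poly_roots_finite finite_subset by blast
  define m where "m = (a + d - sqrt ((a - d)\<^sup>2 + 4 * b\<^sup>2)) / 2"
  define r where "r = sqrt ((a - d)\<^sup>2 + 4 * b\<^sup>2)"
  have r: "r\<^sup>2 = (a - d)\<^sup>2 + 4 * b\<^sup>2" by (simp add: r_def)
  have rge: "\<bar>a - d\<bar> \<le> r" unfolding r_def by (rule real_le_rsqrt) simp
  have m: "m = (a + d - r) / 2" by (simp add: m_def r_def)
  have prod: "(a - m) * (d - m) = b\<^sup>2"
    using r unfolding m by (simp add: field_simps power2_eq_square)
  have am: "a - m \<ge> 0" "d - m \<ge> 0" using rge by (auto simp: m field_simps)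
  \<comment> \<open>The candidate eigenvector (b, m - a) vanishes only if b = 0 and a = m, and then
    (1, 0) is an eigenvector.\<close>
  have "m \<in> E"
  proof (cases "b = 0 \<and> a = m")
    case True
    then show ?thesis unfolding E_def mem_Collect_eq
      by (intro exI[of _ "vector [1, 0]"] conjI, simp add: vec_eq_iff forall_2) (simp add: Av)
  next
    case False
    then show ?thesis unfolding E_def mem_Collect_eq
    proof (intro exI[of _ "vector [b, m - a]"] conjI)
      show "vector [b, m - a] \<noteq> (0 :: real^2)" using False by (auto simp: vec_eq_iff forall_2)
      show "A *v vector [b, m - a] = m *\<^sub>R vector [b, m - a]"
        using prod by (simp add: Av power2_eq_square algebra_simps)
    qed
  qed
  then have "lambda_min A \<le> m" unfolding lambda_min_def E_def[symmetric] using fin by simp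
  then have "lambda_min A * (x\<^sup>2 + y\<^sup>2) \<le> m * (x\<^sup>2 + y\<^sup>2)" by (intro mult_right_mono) auto
  also have "\<dots> \<le> a * x\<^sup>2 + 2 * b * x * y + d * y\<^sup>2"
  proof -
    have "0 \<le> (a - m) * x\<^sup>2 + 2 * b * x * y + (d - m) * y\<^sup>2"
    proof (cases "a - m = 0")
      case True
      then show ?thesis using prod am by simp
    next
      case False
      have "(a - m) * ((a - m) * x\<^sup>2 + 2 * b * x * y + (d - m) * y\<^sup>2)
          = ((a - m) * x + b * y)\<^sup>2 + ((a - m) * (d - m) - b\<^sup>2) * y\<^sup>2"
        by (simp add: algebra_simps power2_eq_square)
      also have "\<dots> \<ge> 0" using prod by simp
      finally show ?thesis using False am by (simp add: zero_le_mult_iff)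
    qed
    then show ?thesis by (simp add: algebra_simps)
  qed
  finally show ?thesis by (simp add: a_def b_def d_def)
qed

lemma design_matrix_form_ge:
  "lambda_min (design_matrix q t) * (x\<^sup>2 + y\<^sup>2) \<le> (\<Sum>i\<in>{1..t}. (x + y * q i)\<^sup>2)"
proof -
  have e: "design_matrix q t $ 1 $ 1 = real t" "design_matrix q t $ 1 $ 2 = (\<Sum>i\<in>{1..t}. q i)"
    "design_matrix q t $ 2 $ 1 = (\<Sum>i\<in>{1..t}. q i)" "design_matrix q t $ 2 $ 2 = (\<Sum>i\<in>{1..t}. (q i)\<^sup>2)"
    by (simp_all add: design_matrix_def pvec_def sum_component power2_eq_square)
  show ?thesis
    using quadratic_form_ge_lambda_min[of "design_matrix q t" x y] unfolding e
    by (simp add: power2_sum power_mult_distrib sum.distrib sum_distrib_left sum_distrib_right algebra_simps)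
qed

section \<open>Revenue near the optimal price\<close>

text \<open>Near \<open>x0\<close>, adding a small parabola to \<phi> keeps the derivative positive
  on the left and negative on the right, so \<open>x0\<close> still maximises. Away from
  \<open>x0\<close>, strict maximality and compactness give a uniform gap, which is divided by the
  squared length of the interval.\<close>

lemma quadratic_growth:
  fixes \<phi> \<phi>' :: "real \<Rightarrow> real"
  assumes cont: "continuous_on {l..u} \<phi>" and x0: "x0 \<in> {l<..<u}"
    and d: "\<And>x. x \<in> {l<..<u} \<Longrightarrow> (\<phi> has_real_derivative \<phi>' x) (at x)"
    and z: "\<phi>' x0 = 0" and dd: "(\<phi>' has_real_derivative m) (at x0)" "m < 0"
    and max: "\<And>x. x \<in> {l..u} \<Longrightarrow> x \<noteq> x0 \<Longrightarrow> \<phi> x < \<phi> x0"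
  obtains \<mu> where "\<mu> > 0" "\<And>x. x \<in> {l..u} \<Longrightarrow> \<mu> * (x - x0)\<^sup>2 \<le> \<phi> x0 - \<phi> x"
proof -
  \<comment> \<open>Half of |m|: the difference quotient of \<open>\<phi>'\<close> tends to m and so
    is eventually below -\<nu>.\<close>
  define \<nu> where "\<nu> = - m / 2"
  have \<nu>: "\<nu> > 0" using dd by (simp add: \<nu>_def)
  have "((\<lambda>x. (\<phi>' x - \<phi>' x0) / (x - x0)) \<longlongrightarrow> m) (at x0)"
    using dd(1) by (simp add: has_field_derivative_iff)
  then have "\<forall>\<^sub>F x in at x0. (\<phi>' x - \<phi>' x0) / (x - x0) < - \<nu>"
    by (rule order_tendstoD) (use dd in \<open>simp add: \<nu>_def\<close>)
  then obtain e0 where e0: "e0 > 0"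
    "\<And>x. x \<noteq> x0 \<Longrightarrow> \<bar>x - x0\<bar> < e0 \<Longrightarrow> \<phi>' x / (x - x0) < - \<nu>"
    by (auto simp: eventually_at dist_real_def z)
  \<comment> \<open>Capped by the distances to the endpoints, so that the neighbourhood stays where
    \<open>\<phi>'\<close> is the derivative of \<phi>.\<close>
  define e where "e = min e0 (min (x0 - l) (u - x0))"
  have e: "e > 0" using e0 x0 by (auto simp: e_def)
  have near: "\<nu> / 2 * (x - x0)\<^sup>2 \<le> \<phi> x0 - \<phi> x" if x: "\<bar>x - x0\<bar> < e" for x
  proof -
    define \<psi> where "\<psi> y = \<phi> y + \<nu> / 2 * (y - x0)\<^sup>2" for y
    have d\<psi>: "(\<psi> has_real_derivative \<phi>' y + \<nu> * (y - x0)) (at y)" if "\<bar>y - x0\<bar> < e" for y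
    proof -
      have "(\<phi> has_real_derivative \<phi>' y) (at y)" using that by (intro d) (auto simp: e_def)
      then show ?thesis unfolding \<psi>_def by (auto intro!: derivative_eq_intros)
    qed
    have sl: "\<phi>' y + \<nu> * (y - x0) < 0" if "x0 < y" "\<bar>y - x0\<bar> < e" for y
      using e0(2)[of y] that by (simp add: e_def field_simps)
    have sr: "\<phi>' y + \<nu> * (y - x0) > 0" if "y < x0" "\<bar>y - x0\<bar> < e" for y
      using e0(2)[of y] that by (simp add: e_def field_simps)
    have "\<psi> x \<le> \<psi> x0"
    proof (cases x x0 rule: linorder_cases)
      case less
      obtain y where "x < y" "y < x0" "\<psi> x0 - \<psi> x = (x0 - x) * (\<phi>' y + \<nu> * (y - x0))"
        using MVT2[OF less, of \<psi> "\<lambda>y. \<phi>' y + \<nu> * (y - x0)"] d\<psi> x by auto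
      then show ?thesis using sr[of y] x less by (smt (verit) mult_pos_pos)
    next
      case greater
      obtain y where "x0 < y" "y < x" "\<psi> x - \<psi> x0 = (x - x0) * (\<phi>' y + \<nu> * (y - x0))"
        using MVT2[OF greater, of \<psi> "\<lambda>y. \<phi>' y + \<nu> * (y - x0)"] d\<psi> x by auto
      then show ?thesis using sl[of y] x greater by (smt (verit) mult_pos_neg)
    qed simp
    then show ?thesis by (simp add: \<psi>_def)
  qed
  define Far where "Far = {l..u} \<inter> {x. e \<le> \<bar>x - x0\<bar>}"
  have "compact Far" unfolding Far_def
    by (intro compact_Int_closed closed_Collect_le continuous_intros) auto
  have "\<exists>g>0. \<forall>x\<in>Far. g \<le> \<phi> x0 - \<phi> x"
  proof (cases "Far = {}")
    case False
    have "continuous_on Far (\<lambda>x. \<phi> x0 - \<phi> x)"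
      by (intro continuous_intros continuous_on_subset[OF cont]) (auto simp: Far_def)
    then obtain y where y: "y \<in> Far" "\<forall>x\<in>Far. \<phi> x0 - \<phi> y \<le> \<phi> x0 - \<phi> x"
      using continuous_attains_inf[OF \<open>compact Far\<close> False] by blast
    moreover have "\<phi> y < \<phi> x0" using y(1) e by (intro max) (auto simp: Far_def)
    ultimately show ?thesis by (intro exI[of _ "\<phi> x0 - \<phi> y"]) auto
  qed (auto intro: exI[of _ 1])
  then obtain g where g: "g > 0" "\<And>x. x \<in> Far \<Longrightarrow> g \<le> \<phi> x0 - \<phi> x" by blast
  define \<mu> where "\<mu> = min (\<nu> / 2) (g / (u - l)\<^sup>2)"
  have lu: "l < u" using x0 by auto
  show ?thesis
  proof
    show "\<mu> > 0" using \<nu> g lu by (simp add: \<mu>_def)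
    fix x assume x: "x \<in> {l..u}"
    show "\<mu> * (x - x0)\<^sup>2 \<le> \<phi> x0 - \<phi> x"
    proof (cases "\<bar>x - x0\<bar> < e")
      case True
      have "\<mu> * (x - x0)\<^sup>2 \<le> \<nu> / 2 * (x - x0)\<^sup>2"
        unfolding \<mu>_def by (intro mult_right_mono min.cobounded1) simp
      then show ?thesis using near[OF True] by linarith
    next
      case False
      have "\<mu> * (x - x0)\<^sup>2 \<le> g / (u - l)\<^sup>2 * (u - l)\<^sup>2"
        unfolding \<mu>_def using x x0 g lu
        by (intro mult_mono min.cobounded2) (auto simp: abs_le_square_iff[symmetric])
      also have "\<dots> = g" using lu by simp
      also have "\<dots> \<le> \<phi> x0 - \<phi> x" using g(2) False x by (simp add: Far_def)
      finally show ?thesis .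
    qed
  qed
qed

text \<open>The partial derivative is the total derivative applied to (1, 0). Working within
  \<open>S\<close> keeps the endpoints of the price interval, where it is one-sided.\<close>

lemma has_real_derivative_fst:
  fixes f :: "real \<times> 'b::real_normed_vector \<Rightarrow> real"
  assumes "(f has_derivative f') (at (x, b) within S \<times> V)" "b \<in> V"
  shows "((\<lambda>x. f (x, b)) has_real_derivative f' (1, 0)) (at x within S)"
proof -
  have "((\<lambda>x. (x, b)) has_derivative (\<lambda>x. (x, 0))) (at x within S)"
    by (auto intro!: derivative_eq_intros)
  moreover have "(f has_derivative f') (at (x, b) within (\<lambda>x. (x, b)) ` S)"
    using assms by (auto intro: has_derivative_subset)
  ultimately have D: "((\<lambda>x. f (x, b)) has_derivative (\<lambda>x. f' (x, 0))) (at x within S)"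
    by (rule has_derivative_in_compose)
  have eq: "(\<lambda>x. f' (x, 0)) = (*) (f' (1, 0))"
  proof
    fix x :: real
    have "f' (x *\<^sub>R (1, 0)) = x *\<^sub>R f' (1, 0)"
      using assms(1) by (intro linear_scale has_derivative_linear)
    then show "f' (x, 0) = f' (1, 0) * x" by (simp add: mult.commute)
  qed
  show ?thesis using D unfolding has_field_derivative_def eq .
qed

text \<open>The price derivative vanishes at the optimum and is Lipschitz, so the loss is quadratic.
  For the maximiser, quadratic growth at \<open>\<beta>0\<close> is played against the Lipschitz
  dependence of the price derivative on \<beta>, giving a linear bound near \<open>\<beta>0\<close>.
  Farther away, also outside \<open>V\<close>, the length of the price range suffices.\<close>

lemma maximizer_bounds:
  fixes r :: "real \<Rightarrow> 'b::euclidean_space \<Rightarrow> real"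
  assumes V: "open V" "\<beta>0 \<in> V"
    and C2: "C2_on (\<lambda>(q, \<beta>). r q \<beta>) ({l..u} \<times> V)"
    and range: "\<And>\<beta>. pm \<beta> \<in> {l..u}"
    and max: "\<And>\<beta> q. \<beta> \<in> V \<Longrightarrow> q \<in> {l..u} \<Longrightarrow> q \<noteq> pm \<beta> \<Longrightarrow> r q \<beta> < r (pm \<beta>) \<beta>"
    and int: "pm \<beta>0 \<in> {l<..<u}"
    and d1: "deriv (\<lambda>q. r q \<beta>0) (pm \<beta>0) = 0"
    and d2: "deriv (deriv (\<lambda>q. r q \<beta>0)) (pm \<beta>0) < 0"
  shows "\<exists>C\<ge>0. (\<forall>q\<in>{l..u}. r (pm \<beta>0) \<beta>0 - r q \<beta>0 \<le> C * (q - pm \<beta>0)\<^sup>2) \<and>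
    (\<forall>\<beta>. (pm \<beta> - pm \<beta>0)\<^sup>2 \<le> C * min 1 ((norm (\<beta> - \<beta>0))\<^sup>2))"
proof -
  define x0 where "x0 = pm \<beta>0"
  define f where "f = (\<lambda>(q, \<beta>). r q \<beta>)"
  obtain Df :: "real \<times> 'b \<Rightarrow> ((real \<times> 'b) \<Rightarrow>\<^sub>L real)"
    and D2f :: "real \<times> 'b \<Rightarrow> ((real \<times> 'b) \<Rightarrow>\<^sub>L ((real \<times> 'b) \<Rightarrow>\<^sub>L real))"
    where Df: "\<And>x. x \<in> {l..u} \<times> V \<Longrightarrow> (f has_derivative Df x) (at x within {l..u} \<times> V)"
      and D2f: "\<And>x. x \<in> {l..u} \<times> V \<Longrightarrow> (Df has_derivative D2f x) (at x within {l..u} \<times> V)"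
      and cD2f: "continuous_on ({l..u} \<times> V) D2f"
    using C2 unfolding C2_on_def f_def by blast
  define g where "g q \<beta> = Df (q, \<beta>) (1, 0)" for q \<beta>
  have g: "((\<lambda>q. r q \<beta>) has_real_derivative g q \<beta>) (at q within {l..u})"
    if "q \<in> {l..u}" "\<beta> \<in> V" for q \<beta>
    using has_real_derivative_fst[OF Df] that by (auto simp: f_def g_def)
  define k where "k = D2f (x0, \<beta>0) (1, 0) (1, 0)"
  have x0: "x0 \<in> {l<..<u}" "x0 \<in> {l..u}" using int by (auto simp: x0_def)
  have at: "at q within {l..u} = at q" if "q \<in> {l<..<u}" for q
    using that by (intro at_within_interior) (simp add: interior_cbox[of l u, simplified])
  have g': "((\<lambda>q. r q \<beta>0) has_real_derivative g q \<beta>0) (at q)" if "q \<in> {l<..<u}" for q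
    using g[of q \<beta>0] V that at[OF that] by auto
  \<comment> \<open>The second price derivative is the entry of \<open>D2f\<close> in the directions
    (1, 0), (1, 0); since \<open>x0\<close> is interior, the derivative within the interval is
    two-sided.\<close>
  have gk: "((\<lambda>q. g q \<beta>0) has_real_derivative k) (at x0)"
  proof -
    have "((\<lambda>x. Df x (1, 0)) has_derivative (\<lambda>h. D2f (x0, \<beta>0) h (1, 0))) (at (x0, \<beta>0) within {l..u} \<times> V)"
      using D2f[of "(x0, \<beta>0)"] x0 V by (intro bounded_linear.has_derivative[OF blinfun.bounded_linear_left]) auto
    from has_real_derivative_fst[OF this V(2)] show ?thesis
      unfolding g_def k_def at[OF x0(1)] by simp
  qed
  have deriv_g: "deriv (\<lambda>q. r q \<beta>0) q = g q \<beta>0" if "q \<in> {l<..<u}" for q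
    using g'[OF that] by (rule DERIV_imp_deriv)
  have gx0: "g x0 \<beta>0 = 0" using d1 deriv_g[OF x0(1)] by (simp add: x0_def)
  have "deriv (deriv (\<lambda>q. r q \<beta>0)) x0 = k"
  proof (rule DERIV_imp_deriv)
    \<comment> \<open>\<open>deriv\<close> is identified with \<open>g\<close> on the open interval
      only, a neighbourhood of \<open>x0\<close>, which is all the outer \<open>deriv\<close>
      depends on.\<close>
    have "\<forall>\<^sub>F q in nhds x0. deriv (\<lambda>q. r q \<beta>0) q = g q \<beta>0"
      using eventually_nhds_in_open[OF open_greaterThanLessThan x0(1)] by eventually_elim (rule deriv_g)
    then show "(deriv (\<lambda>q. r q \<beta>0) has_real_derivative k) (at x0)"
      using gk by (subst DERIV_cong_ev) auto
  qed
  then have k: "k < 0" using d2 by (simp add: x0_def)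
  have rcont: "continuous_on {l..u} (\<lambda>q. r q \<beta>0)"
    using g V by (meson DERIV_continuous_on)
  obtain \<mu> where \<mu>: "\<mu> > 0" "\<And>q. q \<in> {l..u} \<Longrightarrow> \<mu> * (q - x0)\<^sup>2 \<le> r x0 \<beta>0 - r q \<beta>0"
    using quadratic_growth[OF rcont x0(1) g' gx0 gk k] max[OF V(2)] unfolding x0_def by blast
  obtain \<delta> where \<delta>: "\<delta> > 0" "cball \<beta>0 \<delta> \<subseteq> V" using V open_contains_cball by metis
  \<comment> \<open>Compactness of \<open>X\<close> bounds \<open>D2f\<close> by \<open>B\<close>,
    and convexity turns this into a Lipschitz constant of \<open>Df\<close>.\<close>
  define X where "X = {l..u} \<times> cball \<beta>0 \<delta>"
  have XS: "X \<subseteq> {l..u} \<times> V" using \<delta> by (auto simp: X_def)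
  have "compact X" "convex X" unfolding X_def by (auto intro!: compact_Times convex_Times)
  have "compact (D2f ` X)"
    using \<open>compact X\<close> continuous_on_subset[OF cD2f XS] by (rule compact_continuous_image[rotated])
  then obtain B where B: "B > 0" "\<And>x. x \<in> X \<Longrightarrow> norm (D2f x) \<le> B"
    using compact_imp_bounded bounded_pos by (metis imageI)
  have lip: "norm (Df x - Df y) \<le> B * norm (x - y)" if "x \<in> X" "y \<in> X" for x y
  proof (rule differentiable_bound[OF \<open>convex X\<close> _ _ that(1) that(2)])
    show "(Df has_derivative D2f x) (at x within X)" if "x \<in> X" for x
      using D2f[of x] that XS by (blast intro: has_derivative_subset)
    show "onorm (D2f x) \<le> B" if "x \<in> X" for x
      using B(2)[OF that] by (simp add: norm_blinfun.rep_eq)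
  qed
  have glip: "\<bar>g q \<beta> - g q' \<beta>'\<bar> \<le> B * norm ((q, \<beta>) - (q', \<beta>'))"
    if "(q, \<beta>) \<in> X" "(q', \<beta>') \<in> X" for q q' \<beta> \<beta>'
  proof -
    have "\<bar>g q \<beta> - g q' \<beta>'\<bar> = norm ((Df (q, \<beta>) - Df (q', \<beta>')) (1, 0))"
      by (simp add: g_def blinfun.diff_left)
    also have "\<dots> \<le> norm (Df (q, \<beta>) - Df (q', \<beta>')) * norm (1 :: real, 0 :: 'b)" by (rule norm_blinfun)
    also have "\<dots> \<le> B * norm ((q, \<beta>) - (q', \<beta>'))" using lip[OF that] by (simp add: norm_Pair)
    finally show ?thesis .
  qed
  have seg: "{min x0 q..max x0 q} \<subseteq> {l..u}" if "q \<in> {l..u}" for q using that x0 by auto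
  have up: "r x0 \<beta>0 - r q \<beta>0 \<le> B * (q - x0)\<^sup>2" if q: "q \<in> {l..u}" for q
  proof -
    have "norm (r x0 \<beta>0 - r q \<beta>0) \<le> (B * \<bar>q - x0\<bar>) * norm (x0 - q)"
    proof (rule field_differentiable_bound[of "{min x0 q..max x0 q}" "\<lambda>q. r q \<beta>0" "\<lambda>q. g q \<beta>0"])
      fix y assume y: "y \<in> {min x0 q..max x0 q}"
      then show "((\<lambda>q. r q \<beta>0) has_field_derivative g y \<beta>0) (at y within {min x0 q..max x0 q})"
        using g[of y \<beta>0] seg[OF q] V by (blast intro: DERIV_subset)
      have "\<bar>g y \<beta>0 - g x0 \<beta>0\<bar> \<le> B * norm ((y, \<beta>0) - (x0, \<beta>0))"
        using y seg[OF q] x0 \<delta> by (intro glip) (auto simp: X_def)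
      also have "\<dots> \<le> B * \<bar>q - x0\<bar>"
        using y B by (intro mult_left_mono) (auto simp: norm_Pair)
      finally show "norm (g y \<beta>0) \<le> B * \<bar>q - x0\<bar>" by (simp add: gx0)
    qed auto
    then show ?thesis by (simp add: power2_eq_square abs_minus_commute mult.assoc flip: abs_mult)
  qed
  have near: "\<bar>pm \<beta> - x0\<bar> \<le> B / \<mu> * norm (\<beta> - \<beta>0)" if \<beta>: "\<beta> \<in> cball \<beta>0 \<delta>" for \<beta>
  proof (cases "pm \<beta> = x0")
    case False
    have \<beta>V: "\<beta> \<in> V" using \<beta> \<delta> by auto
    define q where "q = pm \<beta>"
    have q: "q \<in> {l..u}" unfolding q_def by (rule range)
    \<comment> \<open>Comparing the gap at \<open>\<beta>0\<close> with the nonpositive gap at \<open>\<beta>\<close> avoids any first-order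
      condition for \<open>pm \<beta>\<close>, which may lie on the boundary.\<close>
    have "norm ((r x0 \<beta>0 - r x0 \<beta>) - (r q \<beta>0 - r q \<beta>)) \<le> (B * norm (\<beta> - \<beta>0)) * norm (x0 - q)"
    proof (rule field_differentiable_bound[of "{l..u}" "\<lambda>q. r q \<beta>0 - r q \<beta>" "\<lambda>q. g q \<beta>0 - g q \<beta>"])
      fix y assume y: "y \<in> {l..u}"
      then show "((\<lambda>q. r q \<beta>0 - r q \<beta>) has_field_derivative g y \<beta>0 - g y \<beta>) (at y within {l..u})"
        using V \<beta>V by (intro derivative_intros g)
      have "\<bar>g y \<beta>0 - g y \<beta>\<bar> \<le> B * norm ((y, \<beta>0) - (y, \<beta>))"
        using y \<beta> \<delta> by (intro glip) (auto simp: X_def)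
      then show "norm (g y \<beta>0 - g y \<beta>) \<le> B * norm (\<beta> - \<beta>0)"
        by (simp add: norm_Pair norm_minus_commute)
    qed (use q x0 in auto)
    moreover have "r x0 \<beta> \<le> r q \<beta>"
      using max[OF \<beta>V, of x0] x0 False by (simp add: q_def)
    ultimately have "\<mu> * (q - x0)\<^sup>2 \<le> B * norm (\<beta> - \<beta>0) * \<bar>q - x0\<bar>"
      using \<mu>(2)[OF q] by (simp add: abs_minus_commute)
    then have "(\<mu> * \<bar>q - x0\<bar>) * \<bar>q - x0\<bar> \<le> (B * norm (\<beta> - \<beta>0)) * \<bar>q - x0\<bar>"
      by (simp add: power2_eq_square)
    then have "\<mu> * \<bar>q - x0\<bar> \<le> B * norm (\<beta> - \<beta>0)"
      using False by (simp add: q_def)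
    then show ?thesis using \<mu>(1) by (simp add: q_def field_simps)
  qed (use B \<mu> in simp)
  define w where "w = u - l"
  have w: "\<bar>pm \<beta> - x0\<bar> \<le> w" for \<beta> using range[of \<beta>] x0 by (auto simp: w_def)
  \<comment> \<open>The entries serve, in order, \<beta> in the ball, the cap at distance one, and
    \<beta> outside the ball, where its distance to \<open>\<beta>0\<close> exceeds
    \<delta>.\<close>
  define E where "E = max (B / \<mu>) (max w (w / \<delta>))"
  have EB: "B / \<mu> \<le> E" "w \<le> E" "w / \<delta> \<le> E" unfolding E_def by simp_all
  have E: "\<bar>pm \<beta> - x0\<bar> \<le> E * min 1 (norm (\<beta> - \<beta>0))" for \<beta>
  proof -
    have w0: "0 \<le> w" using w[of \<beta>0] by simp
    have "\<bar>pm \<beta> - x0\<bar> \<le> E * norm (\<beta> - \<beta>0)"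
    proof (cases "\<beta> \<in> cball \<beta>0 \<delta>")
      case True
      have "B / \<mu> * norm (\<beta> - \<beta>0) \<le> E * norm (\<beta> - \<beta>0)"
        by (intro mult_right_mono EB) simp
      then show ?thesis using near[OF True] by linarith
    next
      case False
      have "w = w / \<delta> * \<delta>" using \<delta> by simp
      also have "\<dots> \<le> E * norm (\<beta> - \<beta>0)"
        using False \<delta> w0 EB by (intro mult_mono EB) (auto simp: dist_norm norm_minus_commute)
      finally show ?thesis using w[of \<beta>] by linarith
    qed
    moreover have "\<bar>pm \<beta> - x0\<bar> \<le> E" using w[of \<beta>] EB(2) by linarith
    ultimately show ?thesis by (simp add: min_def)
  qed
  have sq: "(pm \<beta> - x0)\<^sup>2 \<le> E\<^sup>2 * min 1 ((norm (\<beta> - \<beta>0))\<^sup>2)" for \<beta>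
  proof -
    have "(pm \<beta> - x0)\<^sup>2 = \<bar>pm \<beta> - x0\<bar>\<^sup>2" by simp
    also have "\<dots> \<le> (E * min 1 (norm (\<beta> - \<beta>0)))\<^sup>2" using E by (intro power_mono) auto
    also have "\<dots> = E\<^sup>2 * (min 1 (norm (\<beta> - \<beta>0)))\<^sup>2" by (simp add: power_mult_distrib)
    also have "\<dots> \<le> E\<^sup>2 * min 1 ((norm (\<beta> - \<beta>0))\<^sup>2)"
      by (intro mult_left_mono) (auto simp: min_def power_le_one)
    finally show ?thesis .
  qed
  define C where "C = max B (E\<^sup>2)"
  show ?thesis
  proof (intro exI[of _ C] conjI ballI allI)
    show "0 \<le> C" using B by (simp add: C_def)
    show "r (pm \<beta>0) \<beta>0 - r q \<beta>0 \<le> C * (q - pm \<beta>0)\<^sup>2" if "q \<in> {l..u}" for q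
    proof -
      have "B * (q - x0)\<^sup>2 \<le> C * (q - x0)\<^sup>2" by (intro mult_right_mono) (auto simp: C_def)
      then show ?thesis using up[OF that] by (simp add: x0_def)
    qed
    show "(pm \<beta> - pm \<beta>0)\<^sup>2 \<le> C * min 1 ((norm (\<beta> - \<beta>0))\<^sup>2)" for \<beta>
    proof -
      have "E\<^sup>2 * min 1 ((norm (\<beta> - \<beta>0))\<^sup>2) \<le> C * min 1 ((norm (\<beta> - \<beta>0))\<^sup>2)"
        by (intro mult_right_mono) (auto simp: C_def)
      then show ?thesis using sq[of \<beta>] by (simp add: x0_def)
    qed
  qed
qed

section \<open>Regret\<close>

lemma subalgebra_hist_alg:
  assumes "\<And>i. p i \<in> borel_measurable M" "\<And>i. d i \<in> borel_measurable M" "\<And>i. c i \<in> borel_measurable M"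
  shows "subalgebra M (hist_alg M p d c t)"
proof -
  define G where "G = (\<Union>i\<in>{1..t}. \<Union>X\<in>{p i, d i, c i}. {X -` B \<inter> space M | B. B \<in> sets borel})"
  have "G \<subseteq> sets M" unfolding G_def using assms by (auto intro: measurable_sets)
  moreover from this have "G \<subseteq> Pow (space M)" using sets.space_closed by blast
  ultimately show ?thesis
    unfolding subalgebra_def hist_alg_def G_def[symmetric]
    by (simp add: space_measure_of_conv sets_measure_of sets.sigma_sets_subset)
qed

lemma subalgebra_hist_alg_mono:
  assumes "s \<le> t"
  shows "subalgebra (hist_alg M p d c t) (hist_alg M p d c s)"
proof -
  define G where "G t = (\<Union>i\<in>{1..t}. \<Union>X\<in>{p i, d i, c i}. {X -` B \<inter> space M | B. B \<in> sets borel})" for t :: nat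
  have "G t \<subseteq> Pow (space M)" for t unfolding G_def by blast
  moreover have "G s \<subseteq> G t" unfolding G_def by (rule UN_mono) (use assms in auto)
  ultimately show ?thesis
    unfolding subalgebra_def hist_alg_def G_def[symmetric]
    by (simp add: space_measure_of_conv sets_measure_of sigma_sets_mono')
qed

section \<open>Growth rates\<close>

text \<open>Each term is at most twice an increment of the square root; with x and y the two
  consecutive roots this is (x - y)^2 >= 0.\<close>

lemma sum_inverse_sqrt_le: "(\<Sum>t\<in>{1..T}. 1 / sqrt (real t)) \<le> 2 * sqrt (real T)"
proof (induction T)
  case (Suc T)
  have "1 / sqrt (real (Suc T)) \<le> 2 * (sqrt (real (Suc T)) - sqrt (real T))"
  proof -
    define x y where "x = sqrt (real (Suc T))" and "y = sqrt (real T)"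
    have "x > 0" "x\<^sup>2 = y\<^sup>2 + 1" by (auto simp: x_def y_def)
    moreover have "0 \<le> (x - y)\<^sup>2" by simp
    ultimately have "1 \<le> 2 * (x - y) * x" by (simp add: power2_eq_square algebra_simps)
    then show ?thesis using \<open>x > 0\<close> unfolding x_def[symmetric] y_def[symmetric]
      by (simp add: field_simps)
  qed
  then show ?case using Suc by simp
qed simp

text \<open>Each term is \<open>sqrt (ln t) / (cL * sqrt t)\<close>. Replacing the slowly varying
  numerator by its value at \<open>T\<close> leaves a sum of inverse square roots.\<close>

lemma sum_ln_div_L1_le:
  assumes "cL > 0"
  shows "(\<Sum>t\<in>{1..T}. ln (real t) / L1 cL t) \<le> 2 / cL * sqrt (real T * ln (real T))"
proof (cases "T = 0")
  case False
  have "(\<Sum>t\<in>{1..T}. ln (real t) / L1 cL t) \<le> (\<Sum>t\<in>{1..T}. sqrt (ln (real T)) / cL * (1 / sqrt (real t)))"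
  proof (rule sum_mono)
    fix t assume t: "t \<in> {1..T}"
    \<comment> \<open>The case t = 1 is included: there \<open>ln\<close> and \<open>L1\<close>
      vanish, and division by zero makes both sides of the next identity 0.\<close>
    have l0: "0 \<le> ln (real t)" using t by simp
    have "ln (real t) / L1 cL t = (ln (real t) / sqrt (ln (real t))) / (cL * sqrt (real t))"
      unfolding L1_def by (simp add: real_sqrt_mult mult_ac)
    also have "\<dots> = sqrt (ln (real t)) / (cL * sqrt (real t))"
      using l0 by (simp add: real_div_sqrt)
    also have "\<dots> \<le> sqrt (ln (real T)) / (cL * sqrt (real t))"
      using t assms by (intro divide_right_mono) auto
    finally show "ln (real t) / L1 cL t \<le> sqrt (ln (real T)) / cL * (1 / sqrt (real t))" by simp
  qed
  also have "\<dots> = sqrt (ln (real T)) / cL * (\<Sum>t\<in>{1..T}. 1 / sqrt (real t))"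
    by (simp add: sum_distrib_left)
  also have "\<dots> \<le> sqrt (ln (real T)) / cL * (2 * sqrt (real T))"
    using assms False by (intro mult_left_mono sum_inverse_sqrt_le) auto
  finally show ?thesis by (simp add: real_sqrt_mult mult_ac)
qed simp

lemma L1_mono:
  assumes "cL > 0" "1 \<le> s" "s \<le> t"
  shows "L1 cL s \<le> L1 cL t"
  unfolding L1_def using assms by (intro mult_left_mono real_sqrt_le_mono mult_mono) auto

lemma ln_growth_le:
  fixes R :: real
  shows "\<exists>C\<ge>0. \<forall>t\<ge>2. ln ((1 + real t) * (1 + real t * R\<^sup>2)) \<le> C * ln (real t)"
proof -
  define c where "c = 2 * (1 + R\<^sup>2)"
  have c: "c \<ge> 1" by (simp add: c_def)
  show ?thesis
  \<comment> \<open>The argument of the logarithm is at most \<open>c * t^2\<close>, and for t >= 2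
    the constant \<open>ln c\<close> is at most \<open>ln c / ln 2\<close> times ln t.\<close>
  proof (intro exI[of _ "ln c / ln 2 + 2"] conjI allI impI)
    show "0 \<le> ln c / ln 2 + 2" using c by simp
    fix t :: nat assume t: "2 \<le> t"
    have "(1 + real t) * (1 + real t * R\<^sup>2) \<le> (2 * real t) * (real t * (1 + R\<^sup>2))"
      using t by (intro mult_mono) (auto simp: algebra_simps)
    also have "\<dots> = c * real t ^ 2" by (simp add: c_def power2_eq_square)
    finally have "ln ((1 + real t) * (1 + real t * R\<^sup>2)) \<le> ln (c * real t ^ 2)"
      by (intro ln_mono) (auto intro!: mult_pos_pos add_pos_nonneg)
    also have "\<dots> = ln c + 2 * ln (real t)"
      using c t by (simp add: ln_mult ln_realpow)
    also have "\<dots> \<le> ln c / ln 2 * ln (real t) + 2 * ln (real t)"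
    proof -
      have "ln c / ln 2 * ln 2 \<le> ln c / ln 2 * ln (real t)"
        using c t by (intro mult_left_mono) auto
      then show ?thesis by simp
    qed
    finally show "ln ((1 + real t) * (1 + real t * R\<^sup>2)) \<le> (ln c / ln 2 + 2) * ln (real t)"
      by (simp add: algebra_simps)
  qed
qed

section \<open>The logarithmic moment bound and the error of the estimator\<close>

lemma expectation_self_norm_le_ln:
  fixes p \<eta> :: "nat \<Rightarrow> 'a \<Rightarrow> real"
  assumes "prob_space M"
    and "\<And>i. subalgebra M (F i)" and "\<And>i j. i \<le> j \<Longrightarrow> subalgebra (F j) (F i)"
    and "\<And>t. t \<ge> 1 \<Longrightarrow> p t \<in> borel_measurable (F (t - 1))"
    and "\<And>t \<omega>. t \<ge> 1 \<Longrightarrow> \<omega> \<in> space M \<Longrightarrow> \<bar>p t \<omega>\<bar> \<le> R"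
    and "mds M F \<eta>" and "A1 M F \<eta>"
  shows "\<exists>C\<ge>0. \<forall>t. integrable M (\<lambda>\<omega>. self_norm (\<lambda>i. p i \<omega>) (\<lambda>i. \<eta> i \<omega>) t) \<and>
    (t \<ge> 2 \<longrightarrow> (\<integral>\<omega>. self_norm (\<lambda>i. p i \<omega>) (\<lambda>i. \<eta> i \<omega>) t \<partial>M) \<le> C * ln (real t))"
proof -
  obtain A where A: "A \<ge> 0"
    "\<And>t. integrable M (\<lambda>\<omega>. self_norm (\<lambda>i. p i \<omega>) (\<lambda>i. \<eta> i \<omega>) t)"
    "\<And>t. (\<integral>\<omega>. self_norm (\<lambda>i. p i \<omega>) (\<lambda>i. \<eta> i \<omega>) t \<partial>M) \<le> A * ln ((1 + real t) * (1 + real t * R\<^sup>2))"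
    using expectation_self_norm_le[OF assms] by blast
  obtain B where B: "B \<ge> 0" "\<And>t. t \<ge> 2 \<Longrightarrow> ln ((1 + real t) * (1 + real t * R\<^sup>2)) \<le> B * ln (real t)"
    using ln_growth_le by blast
  show ?thesis
  proof (intro exI[of _ "A * B"] conjI allI impI)
    fix t :: nat assume "2 \<le> t"
    from mult_left_mono[OF B(2)[OF this] A(1)] A(3)[of t]
    show "(\<integral>\<omega>. self_norm (\<lambda>i. p i \<omega>) (\<lambda>i. \<eta> i \<omega>) t \<partial>M) \<le> A * B * ln (real t)"
      by (simp add: mult.assoc)
  qed (use A B in auto)
qed

text \<open>If an MQLE exists, the errors of the two regressions are added. Otherwise one score has
  no zero, so \<open>L\<close> itself is bounded, and the truncated error of an arbitrary \<beta> is
  at most 1. The value chosen by the estimator on that event is therefore irrelevant.\<close>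

lemma MQLE_error_bound:
  fixes h1 h1' h2 h2' :: "real \<Rightarrow> real" and a b :: "real \<times> real"
  assumes h1: "\<And>x. (h1 has_real_derivative h1' x) (at x)" "continuous_on UNIV h1'" "\<And>x. h1' x > 0"
    and h2: "\<And>x. (h2 has_real_derivative h2' x) (at x)" "continuous_on UNIV h2'" "\<And>x. h2' x > 0"
    and L0: "L0 > 0"
  obtains C where "C \<ge> 0"
    "\<And>t (\<omega> :: 'a) L p d c \<beta>. (\<And>i. i \<in> {1..t} \<Longrightarrow> \<bar>p i \<omega>\<bar> \<le> R) \<Longrightarrow> L0 \<le> L \<Longrightarrow>
       L \<le> lambda_min (design_matrix (\<lambda>i. p i \<omega>) t) \<Longrightarrow>
       ((\<exists>\<beta>. is_MQLE p d c h1 h2 t \<omega> \<beta>) \<longrightarrow> is_MQLE p d c h1 h2 t \<omega> \<beta>) \<Longrightarrow>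
       min 1 ((norm (\<beta> - (a, b)))\<^sup>2) * L \<le>
         C * (self_norm (\<lambda>i. p i \<omega>) (\<lambda>i. d i \<omega> - h1 (fst a + snd a * p i \<omega>)) t +
              self_norm (\<lambda>i. p i \<omega>) (\<lambda>i. ln (c i \<omega>) - h2 (fst b + snd b * p i \<omega>)) t)"
proof -
  obtain C1 where C1: "C1 \<ge> 0"
     "\<forall>t q y L. (\<forall>i\<in>{1..t}. \<bar>q i\<bar> \<le> R) \<longrightarrow> L0 \<le> L \<longrightarrow>
     (\<forall>u v. L * (u\<^sup>2 + v\<^sup>2) \<le> (\<Sum>i\<in>{1..t}. (u + v * q i)\<^sup>2)) \<longrightarrow>
     (\<forall>\<alpha>. score h1 q y t \<alpha> = 0 \<longrightarrow>
        min 1 ((norm (\<alpha> - a))\<^sup>2) * L \<le> C1 * self_norm q (\<lambda>i. y i - h1 (fst a + snd a * q i)) t) \<and>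
     ((\<forall>\<alpha>. score h1 q y t \<alpha> \<noteq> 0) \<longrightarrow>
        L \<le> C1 * self_norm q (\<lambda>i. y i - h1 (fst a + snd a * q i)) t)"
    using score_error_bound[OF h1(1,3,2) L0, of R a] by (elim exE conjE)
  obtain C2 where C2: "C2 \<ge> 0"
     "\<forall>t q y L. (\<forall>i\<in>{1..t}. \<bar>q i\<bar> \<le> R) \<longrightarrow> L0 \<le> L \<longrightarrow>
     (\<forall>u v. L * (u\<^sup>2 + v\<^sup>2) \<le> (\<Sum>i\<in>{1..t}. (u + v * q i)\<^sup>2)) \<longrightarrow>
     (\<forall>\<alpha>. score h2 q y t \<alpha> = 0 \<longrightarrow>
        min 1 ((norm (\<alpha> - b))\<^sup>2) * L \<le> C2 * self_norm q (\<lambda>i. y i - h2 (fst b + snd b * q i)) t) \<and>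
     ((\<forall>\<alpha>. score h2 q y t \<alpha> \<noteq> 0) \<longrightarrow>
        L \<le> C2 * self_norm q (\<lambda>i. y i - h2 (fst b + snd b * q i)) t)"
    using score_error_bound[OF h2(1,3,2) L0, of R b] by (elim exE conjE)
  show ?thesis
  proof (rule that[of "C1 + C2"])
    show "0 \<le> C1 + C2" using C1 C2 by simp
    fix t and \<omega> :: 'a and L :: real and p d c :: "nat \<Rightarrow> 'a \<Rightarrow> real" and \<beta> :: param
    assume p: "\<And>i. i \<in> {1..t} \<Longrightarrow> \<bar>p i \<omega>\<bar> \<le> R" and L: "L0 \<le> L"
      and lam: "L \<le> lambda_min (design_matrix (\<lambda>i. p i \<omega>) t)"
      and mqle: "(\<exists>\<beta>. is_MQLE p d c h1 h2 t \<omega> \<beta>) \<longrightarrow> is_MQLE p d c h1 h2 t \<omega> \<beta>"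
    let ?q = "\<lambda>i. p i \<omega>" and ?y = "\<lambda>i. d i \<omega>" and ?z = "\<lambda>i. ln (c i \<omega>)"
    define Q1 where "Q1 = self_norm ?q (\<lambda>i. d i \<omega> - h1 (fst a + snd a * p i \<omega>)) t"
    define Q2 where "Q2 = self_norm ?q (\<lambda>i. ln (c i \<omega>) - h2 (fst b + snd b * p i \<omega>)) t"
    have Q: "0 \<le> Q1" "0 \<le> Q2" by (simp_all add: Q1_def Q2_def self_norm_nonneg)
    have form: "\<forall>u v. L * (u\<^sup>2 + v\<^sup>2) \<le> (\<Sum>i\<in>{1..t}. (u + v * p i \<omega>)\<^sup>2)"
    proof (intro allI)
      fix u v :: real
      have "L * (u\<^sup>2 + v\<^sup>2) \<le> lambda_min (design_matrix ?q t) * (u\<^sup>2 + v\<^sup>2)"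
        using lam by (intro mult_right_mono) auto
      also have "\<dots> \<le> (\<Sum>i\<in>{1..t}. (u + v * p i \<omega>)\<^sup>2)" by (rule design_matrix_form_ge)
      finally show "L * (u\<^sup>2 + v\<^sup>2) \<le> (\<Sum>i\<in>{1..t}. (u + v * p i \<omega>)\<^sup>2)" .
    qed
    have "(\<forall>\<alpha>. score h1 ?q ?y t \<alpha> = 0 \<longrightarrow> min 1 ((norm (\<alpha> - a))\<^sup>2) * L \<le> C1 * Q1) \<and>
        ((\<forall>\<alpha>. score h1 ?q ?y t \<alpha> \<noteq> 0) \<longrightarrow> L \<le> C1 * Q1)"
      unfolding Q1_def by (intro C1(2)[THEN spec, THEN spec, THEN spec, THEN spec, THEN mp, THEN mp, THEN mp] ballI p L form)
    then have B1: "score h1 ?q ?y t \<alpha> = 0 \<Longrightarrow> min 1 ((norm (\<alpha> - a))\<^sup>2) * L \<le> C1 * Q1"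
      "(\<forall>\<alpha>. score h1 ?q ?y t \<alpha> \<noteq> 0) \<Longrightarrow> L \<le> C1 * Q1" for \<alpha>
      by blast+
    have "(\<forall>\<alpha>. score h2 ?q ?z t \<alpha> = 0 \<longrightarrow> min 1 ((norm (\<alpha> - b))\<^sup>2) * L \<le> C2 * Q2) \<and>
        ((\<forall>\<alpha>. score h2 ?q ?z t \<alpha> \<noteq> 0) \<longrightarrow> L \<le> C2 * Q2)"
      unfolding Q2_def by (intro C2(2)[THEN spec, THEN spec, THEN spec, THEN spec, THEN mp, THEN mp, THEN mp] ballI p L form)
    then have B2: "score h2 ?q ?z t \<alpha> = 0 \<Longrightarrow> min 1 ((norm (\<alpha> - b))\<^sup>2) * L \<le> C2 * Q2"
      "(\<forall>\<alpha>. score h2 ?q ?z t \<alpha> \<noteq> 0) \<Longrightarrow> L \<le> C2 * Q2" for \<alpha>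
      by blast+
    have nn: "0 \<le> C1 * Q1" "0 \<le> C2 * Q2" "0 \<le> C1 * Q2" "0 \<le> C2 * Q1" using C1 C2 Q by auto
    have Lnn: "0 \<le> L" using L L0 by simp
    have "min 1 ((norm (\<beta> - (a, b)))\<^sup>2) * L \<le> C1 * Q1 + C2 * Q2"
    proof (cases "\<exists>\<beta>. is_MQLE p d c h1 h2 t \<omega> \<beta>")
      case True
      then have sol: "score h1 ?q ?y t (fst \<beta>) = 0" "score h2 ?q ?z t (snd \<beta>) = 0"
        using mqle by (auto simp: is_MQLE_iff_score)
      have "(norm (\<beta> - (a, b)))\<^sup>2 = (norm (fst \<beta> - a))\<^sup>2 + (norm (snd \<beta> - b))\<^sup>2"
        by (cases \<beta>) (simp add: norm_Pair)
      \<comment> \<open>Truncation at 1 is subadditive on nonnegative numbers.\<close>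
      then have "min 1 ((norm (\<beta> - (a, b)))\<^sup>2)
          \<le> min 1 ((norm (fst \<beta> - a))\<^sup>2) + min 1 ((norm (snd \<beta> - b))\<^sup>2)"
        using zero_le_power2[of "norm (fst \<beta> - a)"] zero_le_power2[of "norm (snd \<beta> - b)"] by linarith
      from mult_right_mono[OF this Lnn] B1(1)[OF sol(1)] B2(1)[OF sol(2)]
      show ?thesis by (simp add: distrib_right)
    next
      case False
      then have "(\<forall>\<alpha>. score h1 ?q ?y t \<alpha> \<noteq> 0) \<or> (\<forall>\<alpha>. score h2 ?q ?z t \<alpha> \<noteq> 0)"
        unfolding is_MQLE_iff_score by (metis fst_conv snd_conv)
      then have "L \<le> C1 * Q1 + C2 * Q2" using B1(2) B2(2) nn by (auto intro: order_trans add_increasing add_increasing2)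
      moreover have "min 1 ((norm (\<beta> - (a, b)))\<^sup>2) * L \<le> 1 * L" using Lnn by (intro mult_right_mono) auto
      ultimately show ?thesis by linarith
    qed
    also have "\<dots> \<le> (C1 + C2) * (Q1 + Q2)" using nn by (simp add: algebra_simps)
    finally show "min 1 ((norm (\<beta> - (a, b)))\<^sup>2) * L \<le> (C1 + C2) *
       (self_norm ?q (\<lambda>i. d i \<omega> - h1 (fst a + snd a * p i \<omega>)) t +
        self_norm ?q (\<lambda>i. ln (c i \<omega>) - h2 (fst b + snd b * p i \<omega>)) t)"
      unfolding Q1_def Q2_def .
  qed
qed

theorem theorem1:
  fixes M :: "'a measure"
    and p d c :: "nat \<Rightarrow> 'a \<Rightarrow> real"
    and pl ph a0 a1 b0 b1 cL K :: real
    and h1 h1' h2 h2' :: "real \<Rightarrow> real"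
    and \<beta>h :: "nat \<Rightarrow> 'a \<Rightarrow> param"
    and r :: "real \<Rightarrow> param \<Rightarrow> real"
    and pfun :: "param \<Rightarrow> real"
    and V :: "param set"
    and t0 :: nat
  defines "F \<equiv> hist_alg M p d c"
    and "\<beta>0 \<equiv> ((a0, a1), (b0, b1))"
  assumes M: "prob_space M"
    and prices: "0 < pl" "pl < ph"
    and p_range: "\<forall>t\<ge>1. \<forall>\<omega>\<in>space M. p t \<omega> \<in> {pl..ph}"
    and p_meas: "\<forall>t. p t \<in> borel_measurable M"
    and d_meas: "\<forall>t. d t \<in> borel_measurable M"
    and c_meas: "\<forall>t. c t \<in> borel_measurable M"
    and p_pred: "\<forall>t\<ge>1. p t \<in> borel_measurable (F (t - 1))"
    and c_pos: "\<forall>t\<ge>1. \<forall>\<omega>\<in>space M. c t \<omega> > 0"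
    and h1_diff: "\<forall>x. (h1 has_real_derivative h1' x) (at x)" "continuous_on UNIV h1'" "\<forall>x. h1' x > 0"
    and h2_diff: "\<forall>x. (h2 has_real_derivative h2' x) (at x)" "continuous_on UNIV h2'" "\<forall>x. h2' x > 0"
    and d_int: "\<forall>t\<ge>1. integrable M (d t)"
    and logc_int: "\<forall>t\<ge>1. integrable M (\<lambda>\<omega>. ln (c t \<omega>))"
    and demand: "\<forall>t\<ge>1. AE \<omega> in M. real_cond_exp M (F (t - 1)) (d t) \<omega> = h1 (a0 + a1 * p t \<omega>)"
    and claims: "\<forall>t\<ge>1. AE \<omega> in M. real_cond_exp M (F (t - 1)) (\<lambda>\<omega>. ln (c t \<omega>)) \<omega>
                   = h2 (b0 + b1 * p t \<omega>)"
    and mds1: "mds M F (\<lambda>i \<omega>. d i \<omega> - h1 (pvec (p i \<omega>) \<bullet> vec2 (a0, a1)))"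
    and mds2: "mds M F (\<lambda>i \<omega>. ln (c i \<omega>) - h2 (pvec (p i \<omega>) \<bullet> vec2 (b0, b1)))"
    and A1_1: "A1 M F (\<lambda>i \<omega>. d i \<omega> - h1 (pvec (p i \<omega>) \<bullet> vec2 (a0, a1)))"
    and A1_2: "A1 M F (\<lambda>i \<omega>. ln (c i \<omega>) - h2 (pvec (p i \<omega>) \<bullet> vec2 (b0, b1)))"
    and mqle: "\<forall>t\<ge>1. \<forall>\<omega>\<in>space M. (\<exists>\<beta>. is_MQLE p d c h1 h2 t \<omega> \<beta>) \<longrightarrow> is_MQLE p d c h1 h2 t \<omega> (\<beta>h t \<omega>)"
    and mqle_meas: "\<forall>t. \<beta>h t \<in> borel_measurable (F t)"
    and V: "open V" "bounded V" "\<beta>0 \<in> V"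
    and r_C2: "C2_on (\<lambda>(q, \<beta>). r q \<beta>) ({pl..ph} \<times> V)"
    and pfun_range: "\<forall>\<beta>. pfun \<beta> \<in> {pl..ph}"
    and pfun_max: "\<forall>\<beta>\<in>V. \<forall>q\<in>{pl..ph}. q \<noteq> pfun \<beta> \<longrightarrow> r q \<beta> < r (pfun \<beta>) \<beta>"
    and pstar_int: "pfun \<beta>0 \<in> {pl<..<ph}"
    and pstar_d1: "deriv (\<lambda>q. r q \<beta>0) (pfun \<beta>0) = 0"
    and pstar_d2: "deriv (deriv (\<lambda>q. r q \<beta>0)) (pfun \<beta>0) < 0"
    and cL: "cL > 0"
    and K: "K > 0"
    and consistent: "AE \<omega> in M. (\<lambda>t. \<beta>h t \<omega>) \<longlonglongrightarrow> \<beta>0"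
    and cond1: "\<forall>t\<ge>t0. AE \<omega> in M. lambda_min (design_matrix (\<lambda>i. p i \<omega>) t) \<ge> L1 cL t"
    and cond2: "\<forall>T\<ge>t0. AE \<omega> in M.
                  (\<Sum>t\<in>{1..T}. \<bar>p t \<omega> - pfun (\<beta>h t \<omega>)\<bar>\<^sup>2) \<le> K * L1 cL T"
  shows "(\<lambda>T. regret M r \<beta>0 (pfun \<beta>0) p T)
           \<in> O(\<lambda>T. L1 cL T + (\<Sum>t\<in>{1..T}. ln (real t) / L1 cL t)) \<and>
         (\<lambda>T. regret M r \<beta>0 (pfun \<beta>0) p T) \<in> O(\<lambda>T. sqrt (real T * ln (real T)))"
proof -
  interpret prob_space M by fact
  define ps where "ps = pfun \<beta>0"
  define e1 where "e1 i \<omega> = d i \<omega> - h1 (a0 + a1 * p i \<omega>)" for i \<omega>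
  define e2 where "e2 i \<omega> = ln (c i \<omega>) - h2 (b0 + b1 * p i \<omega>)" for i \<omega>
  define Q where "Q t \<omega> = self_norm (\<lambda>i. p i \<omega>) (\<lambda>i. e1 i \<omega>) t + self_norm (\<lambda>i. p i \<omega>) (\<lambda>i. e2 i \<omega>) t" for t \<omega>
  \<comment> \<open>From \<open>N\<close> on the eigenvalue condition is available and
    \<open>L1\<close> is positive; \<open>L1 cL 1\<close> is 0.\<close>
  define N where "N = max t0 2"
  have e1: "mds M F e1" "A1 M F e1" and e2: "mds M F e2" "A1 M F e2"
    using mds1 A1_1 mds2 A1_2 by (simp_all add: pvec_vec2 e1_def[abs_def] e2_def[abs_def])
  have sub: "subalgebra M (F i)" for i
    unfolding F_def using p_meas d_meas c_meas by (intro subalgebra_hist_alg) auto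
  have submono: "i \<le> j \<Longrightarrow> subalgebra (F j) (F i)" for i j
    unfolding F_def by (rule subalgebra_hist_alg_mono)
  have p_le: "\<bar>p t \<omega>\<bar> \<le> ph" if "t \<ge> 1" "\<omega> \<in> space M" for t \<omega>
    using p_range[rule_format, OF that] prices by simp
  obtain A where A: "A \<ge> 0" "\<And>t. integrable M (Q t)" "\<And>t. t \<ge> 2 \<Longrightarrow> (\<integral>\<omega>. Q t \<omega> \<partial>M) \<le> A * ln (real t)"
  proof -
    obtain A1 where A1: "A1 \<ge> 0" "\<And>t. integrable M (\<lambda>\<omega>. self_norm (\<lambda>i. p i \<omega>) (\<lambda>i. e1 i \<omega>) t)"
      "\<And>t. t \<ge> 2 \<Longrightarrow> (\<integral>\<omega>. self_norm (\<lambda>i. p i \<omega>) (\<lambda>i. e1 i \<omega>) t \<partial>M) \<le> A1 * ln (real t)"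
      using expectation_self_norm_le_ln[OF M sub submono p_pred[rule_format] p_le e1] by blast
    obtain A2 where A2: "A2 \<ge> 0" "\<And>t. integrable M (\<lambda>\<omega>. self_norm (\<lambda>i. p i \<omega>) (\<lambda>i. e2 i \<omega>) t)"
      "\<And>t. t \<ge> 2 \<Longrightarrow> (\<integral>\<omega>. self_norm (\<lambda>i. p i \<omega>) (\<lambda>i. e2 i \<omega>) t \<partial>M) \<le> A2 * ln (real t)"
      using expectation_self_norm_le_ln[OF M sub submono p_pred[rule_format] p_le e2] by blast
    show ?thesis
    proof (rule that[of "A1 + A2"])
      show "integrable M (Q t)" for t using A1(2) A2(2) by (simp add: Q_def[abs_def])
      show "(\<integral>\<omega>. Q t \<omega> \<partial>M) \<le> (A1 + A2) * ln (real t)" if "t \<ge> 2" for t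
        using A1(2,3)[of t] A2(2,3)[of t] that by (simp add: Q_def[abs_def] distrib_right)
    qed (use A1 A2 in simp)
  qed
  have Q0: "0 \<le> Q t \<omega>" for t \<omega> by (simp add: Q_def self_norm_nonneg)
  obtain C0 where C0: "C0 \<ge> 0" "\<And>x. x \<in> {pl..ph} \<Longrightarrow> r ps \<beta>0 - r x \<beta>0 \<le> C0 * (x - ps)\<^sup>2"
    "\<And>\<beta>. (pfun \<beta> - ps)\<^sup>2 \<le> C0 * min 1 ((norm (\<beta> - \<beta>0))\<^sup>2)"
    using maximizer_bounds[OF V(1,3) r_C2 pfun_range[rule_format] pfun_max[rule_format] pstar_int pstar_d1 pstar_d2]
    unfolding ps_def by blast
  have L2: "0 < L1 cL 2" using cL by (simp add: L1_def)
  have L1_0: "0 \<le> L1 cL t" for t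
    using cL by (cases "t = 0") (simp_all add: L1_def)
  have L1_ge: "L1 cL 2 \<le> L1 cL t" if "t \<ge> 2" for t using cL that by (intro L1_mono) auto
  \<comment> \<open>The uniform lower bound \<open>L0\<close> is taken to be \<open>L1 cL 2\<close>,
    since \<open>L1\<close> increases from index 1 on.\<close>
  obtain C1 where C1: "C1 \<ge> 0"
    "\<And>t \<omega> L p d c \<beta>. (\<And>i. i \<in> {1..t} \<Longrightarrow> \<bar>p i (\<omega>::'a)\<bar> \<le> ph) \<Longrightarrow> L1 cL 2 \<le> L \<Longrightarrow>
       L \<le> lambda_min (design_matrix (\<lambda>i. p i \<omega>) t) \<Longrightarrow>
       ((\<exists>\<beta>. is_MQLE p d c h1 h2 t \<omega> \<beta>) \<longrightarrow> is_MQLE p d c h1 h2 t \<omega> \<beta>) \<Longrightarrow>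
       min 1 ((norm (\<beta> - \<beta>0))\<^sup>2) * L \<le>
         C1 * (self_norm (\<lambda>i. p i \<omega>) (\<lambda>i. d i \<omega> - h1 (a0 + a1 * p i \<omega>)) t +
               self_norm (\<lambda>i. p i \<omega>) (\<lambda>i. ln (c i \<omega>) - h2 (b0 + b1 * p i \<omega>)) t)"
    by (fact MQLE_error_bound[OF h1_diff(1)[rule_format] h1_diff(2) h1_diff(3)[rule_format]
        h2_diff(1)[rule_format] h2_diff(2) h2_diff(3)[rule_format] L2,
        where a = "(a0, a1)" and b = "(b0, b1)" and R = ph, unfolded fst_conv snd_conv, folded \<beta>0_def])
  have maximizer_error: "(pfun (\<beta>h t \<omega>) - ps)\<^sup>2 \<le> C0 * C1 * (Q t \<omega> / L1 cL t)"
    if \<omega>: "\<omega> \<in> space M" and t: "t \<ge> N" and lam: "L1 cL t \<le> lambda_min (design_matrix (\<lambda>i. p i \<omega>) t)"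
    for t \<omega>
  proof -
    have t2: "t \<ge> 2" using t by (simp add: N_def)
    have Lpos: "0 < L1 cL t" using L1_ge[OF t2] L2 by linarith
    have "min 1 ((norm (\<beta>h t \<omega> - \<beta>0))\<^sup>2) * L1 cL t \<le> C1 * Q t \<omega>"
      unfolding Q_def e1_def e2_def
      by (rule C1(2)[of t p \<omega> "L1 cL t" d c "\<beta>h t \<omega>", OF _ L1_ge[OF t2] lam]) (use \<omega> p_le mqle t2 in auto)
    then have "min 1 ((norm (\<beta>h t \<omega> - \<beta>0))\<^sup>2) \<le> C1 * Q t \<omega> / L1 cL t"
      using Lpos by (simp add: pos_le_divide_eq)
    then have "C0 * min 1 ((norm (\<beta>h t \<omega> - \<beta>0))\<^sup>2) \<le> C0 * (C1 * Q t \<omega> / L1 cL t)"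
      using C0(1) by (rule mult_left_mono)
    then show ?thesis using C0(3)[of "\<beta>h t \<omega>"] by (simp add: mult.assoc)
  qed

  \<comment> \<open>Pathwise bound on the revenue loss\<close>
  define S where "S T = (\<Sum>t\<in>{1..T}. ln (real t) / L1 cL t)" for T
  \<comment> \<open>A random majorant of the loss. The factor 2 comes from (x + y)^2 <= 2 (x^2 +
    y^2); \<open>K * L1 cL T\<close> pays for the deviations from the estimated optimum,
    \<open>C0 * real N\<close> for the periods before \<open>N\<close> via the truncation at 1, and
    the last sum for the later estimation errors.\<close>
  define B where "B T \<omega> = 2 * C0 * (K * L1 cL T + (C0 * real N + C0 * C1 * (\<Sum>t\<in>{1..T}. Q t \<omega> / L1 cL t)))" for T \<omega>
  \<comment> \<open>Countably many null sets are merged, so that the eigenvalue bounds hold for all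
    \<open>t\<close> along one path.\<close>
  have lam_AE: "AE \<omega> in M. \<forall>t\<ge>t0. L1 cL t \<le> lambda_min (design_matrix (\<lambda>i. p i \<omega>) t)"
    using cond1 by (simp add: AE_all_countable)
  have pathwise: "AE \<omega> in M. (\<Sum>t\<in>{1..T}. r ps \<beta>0 - r (p t \<omega>) \<beta>0) \<le> B T \<omega>" if T: "T \<ge> t0" for T
    using lam_AE cond2[rule_format, OF T] AE_space
  proof eventually_elim
    case (elim \<omega>)
    have "(\<Sum>t\<in>{1..T}. (pfun (\<beta>h t \<omega>) - ps)\<^sup>2)
        \<le> (\<Sum>t\<in>{1..T}. (if t < N then C0 else 0) + C0 * C1 * (Q t \<omega> / L1 cL t))"
    proof (rule sum_mono)
      fix t
      have nn: "0 \<le> C0 * C1 * (Q t \<omega> / L1 cL t)" using C0(1) C1(1) Q0 L1_0 by simp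
      show "(pfun (\<beta>h t \<omega>) - ps)\<^sup>2 \<le> (if t < N then C0 else 0) + C0 * C1 * (Q t \<omega> / L1 cL t)"
      proof (cases "t < N")
        case True
        have "C0 * min 1 ((norm (\<beta>h t \<omega> - \<beta>0))\<^sup>2) \<le> C0 * 1" using C0(1) by (intro mult_left_mono) auto
        then show ?thesis using C0(3)[of "\<beta>h t \<omega>"] nn True by simp
      next
        case False
        then have "t \<ge> N" "t \<ge> t0" by (auto simp: N_def)
        then show ?thesis using maximizer_error[of \<omega> t] elim False by simp
      qed
    qed
    also have "\<dots> = (\<Sum>t\<in>{1..T}. if t < N then C0 else 0) + C0 * C1 * (\<Sum>t\<in>{1..T}. Q t \<omega> / L1 cL t)"
      by (simp add: sum.distrib sum_distrib_left)
    also have "(\<Sum>t\<in>{1..T}. if t < N then C0 else 0) = C0 * real (card ({1..T} \<inter> {t. t < N}))"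
      by (simp add: sum.If_cases)
    also have "\<dots> \<le> C0 * real N"
      using C0(1) card_mono[of "{..<N}" "{1..T} \<inter> {t. t < N}"] by (intro mult_left_mono) auto
    finally have est: "(\<Sum>t\<in>{1..T}. (pfun (\<beta>h t \<omega>) - ps)\<^sup>2)
        \<le> C0 * real N + C0 * C1 * (\<Sum>t\<in>{1..T}. Q t \<omega> / L1 cL t)" by simp
    have "(\<Sum>t\<in>{1..T}. r ps \<beta>0 - r (p t \<omega>) \<beta>0)
        \<le> (\<Sum>t\<in>{1..T}. 2 * C0 * (\<bar>p t \<omega> - pfun (\<beta>h t \<omega>)\<bar>\<^sup>2 + (pfun (\<beta>h t \<omega>) - ps)\<^sup>2))"
    proof (rule sum_mono)
      fix t assume t: "t \<in> {1..T}"
      define x y where "x = p t \<omega> - pfun (\<beta>h t \<omega>)" and "y = pfun (\<beta>h t \<omega>) - ps"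
      have "(p t \<omega> - ps)\<^sup>2 = (x + y)\<^sup>2" by (simp add: x_def y_def)
      also have "\<dots> \<le> 2 * (x\<^sup>2 + y\<^sup>2)"
        using sum_squares_bound[of x y] by (simp add: power2_sum)
      finally have "C0 * (p t \<omega> - ps)\<^sup>2 \<le> C0 * (2 * (x\<^sup>2 + y\<^sup>2))" using C0(1) by (rule mult_left_mono)
      moreover have "r ps \<beta>0 - r (p t \<omega>) \<beta>0 \<le> C0 * (p t \<omega> - ps)\<^sup>2"
        using p_range t elim by (intro C0(2)) auto
      ultimately have "r ps \<beta>0 - r (p t \<omega>) \<beta>0 \<le> 2 * C0 * (x\<^sup>2 + y\<^sup>2)"
        by (simp add: algebra_simps)
      then show "r ps \<beta>0 - r (p t \<omega>) \<beta>0
          \<le> 2 * C0 * (\<bar>p t \<omega> - pfun (\<beta>h t \<omega>)\<bar>\<^sup>2 + (pfun (\<beta>h t \<omega>) - ps)\<^sup>2)"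
        by (simp add: x_def y_def)
    qed
    also have "\<dots> = 2 * C0 * ((\<Sum>t\<in>{1..T}. \<bar>p t \<omega> - pfun (\<beta>h t \<omega>)\<bar>\<^sup>2) + (\<Sum>t\<in>{1..T}. (pfun (\<beta>h t \<omega>) - ps)\<^sup>2))"
      by (simp only: sum_distrib_left[symmetric] sum.distrib)
    also have "\<dots> \<le> B T \<omega>"
      unfolding B_def using elim est C0(1) by (intro mult_left_mono add_mono) auto
    finally show ?case .
  qed

  \<comment> \<open>Passing to expectations\<close>
  have Bi: "integrable M (B T)" for T
    unfolding B_def using A(2) by simp
  have EB: "(\<integral>\<omega>. B T \<omega> \<partial>M) \<le> 2 * C0 * (K * L1 cL T + (C0 * real N + C0 * C1 * (A * S T)))" for T
  proof -
    have "(\<integral>\<omega>. B T \<omega> \<partial>M)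
        = 2 * C0 * (K * L1 cL T + (C0 * real N + C0 * C1 * (\<Sum>t\<in>{1..T}. (\<integral>\<omega>. Q t \<omega> \<partial>M) / L1 cL t)))"
      unfolding B_def using A(2) by (simp add: prob_space)
    moreover have "(\<Sum>t\<in>{1..T}. (\<integral>\<omega>. Q t \<omega> \<partial>M) / L1 cL t) \<le> A * S T"
      unfolding S_def sum_distrib_left
    proof (rule sum_mono)
      fix t assume "t \<in> {1..T}"
      then consider "t = 1" | "t \<ge> 2" by force
      then show "(\<integral>\<omega>. Q t \<omega> \<partial>M) / L1 cL t \<le> A * (ln (real t) / L1 cL t)"
      proof cases \<comment> \<open>at \<open>t = 1\<close> both sides are divisions by \<open>L1 cL 1 = 0\<close>\<close>
        case 2
        then show ?thesis using divide_right_mono[OF A(3)[OF 2] L1_0[of t]] by simp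
      qed (simp add: L1_def)
    qed
    ultimately show ?thesis using C0(1) C1(1) by (simp add: mult_left_mono)
  qed
  have regret_nonneg: "0 \<le> regret M r \<beta>0 ps p T" for T
    unfolding regret_def
  proof (intro integral_nonneg_AE AE_I2 sum_nonneg)
    fix \<omega> t assume "\<omega> \<in> space M" "t \<in> {1..T}"
    then have "p t \<omega> \<in> {pl..ph}" using p_range by auto
    then show "0 \<le> r ps \<beta>0 - r (p t \<omega>) \<beta>0"
      using pfun_max V(3) unfolding ps_def by (cases "p t \<omega> = pfun \<beta>0") (auto intro: less_imp_le)
  qed
  have regret_le: "regret M r \<beta>0 ps p T \<le> 2 * C0 * (K * L1 cL T + (C0 * real N + C0 * C1 * (A * S T)))"
    if T: "T \<ge> t0" for T
  proof -
    \<comment> \<open>If the loss is not integrable, its Bochner integral is 0 by convention, still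
      below the nonnegative expectation of \<open>B T\<close>.\<close>
    have "regret M r \<beta>0 ps p T \<le> (\<integral>\<omega>. B T \<omega> \<partial>M)"
    proof (cases "integrable M (\<lambda>\<omega>. \<Sum>t\<in>{1..T}. r ps \<beta>0 - r (p t \<omega>) \<beta>0)")
      case True
      then show ?thesis unfolding regret_def using Bi pathwise[OF T] by (rule integral_mono_AE)
    next
      case False
      have "0 \<le> (\<integral>\<omega>. B T \<omega> \<partial>M)"
        unfolding B_def using C0(1) C1(1) K Q0 L1_0
        by (intro integral_nonneg_AE AE_I2 mult_nonneg_nonneg add_nonneg_nonneg sum_nonneg divide_nonneg_nonneg) auto
      then show ?thesis unfolding regret_def using False by (simp add: not_integrable_integral_eq)
    qed
    also note EB
    finally show ?thesis .
  qed

  \<comment> \<open>Orders of growth\<close>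
  have S0: "0 \<le> S T" for T unfolding S_def using L1_0 by (intro sum_nonneg divide_nonneg_nonneg) auto
  \<comment> \<open>The quotient by \<open>L1 cL 2\<close> absorbs the fixed cost of the first
    \<open>N\<close> periods into a multiple of \<open>L1 cL T\<close>, as T >= 2.\<close>
  define D where "D = 2 * C0 * (K + C0 * real N / L1 cL 2 + C0 * C1 * A)"
  have D0: "0 \<le> D" using C0(1) C1(1) K L2 A(1) by (simp add: D_def)
  have main: "regret M r \<beta>0 ps p T \<le> D * (L1 cL T + S T)" if T: "T \<ge> N" for T
  proof -
    have T2: "T \<ge> t0" "T \<ge> 2" using T by (auto simp: N_def)
    define k where "k = C0 * real N / L1 cL 2"
    have k: "0 \<le> k" "k * L1 cL 2 = C0 * real N" using C0(1) L2 by (auto simp: k_def)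
    have "C0 * real N \<le> k * L1 cL T"
      using mult_left_mono[OF L1_ge[OF T2(2)] k(1)] k(2) by simp
    moreover have "0 \<le> (K + k) * S T" "0 \<le> C0 * C1 * A * L1 cL T"
      using K k C0(1) C1(1) A(1) S0 L1_0 by auto
    ultimately have "K * L1 cL T + (C0 * real N + C0 * C1 * (A * S T)) \<le> (K + k + C0 * C1 * A) * (L1 cL T + S T)"
      by (simp add: algebra_simps)
    then have "2 * C0 * (K * L1 cL T + (C0 * real N + C0 * C1 * (A * S T)))
        \<le> 2 * C0 * ((K + k + C0 * C1 * A) * (L1 cL T + S T))"
      using C0(1) by (intro mult_left_mono) auto
    then show ?thesis using regret_le[OF T2(1)] by (simp add: D_def k_def mult.assoc)
  qed
  have "(\<lambda>T. regret M r \<beta>0 ps p T) \<in> O(\<lambda>T. L1 cL T + S T)"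
  proof (rule bigoI)
    show "\<forall>\<^sub>F T in sequentially. norm (regret M r \<beta>0 ps p T) \<le> D * norm (L1 cL T + S T)"
      using eventually_ge_at_top[of N]
      by eventually_elim (use main regret_nonneg S0 L1_0 in simp)
  qed
  moreover have "(\<lambda>T. regret M r \<beta>0 ps p T) \<in> O(\<lambda>T. sqrt (real T * ln (real T)))"
  proof (rule bigoI)
    show "\<forall>\<^sub>F T in sequentially. norm (regret M r \<beta>0 ps p T)
        \<le> D * (cL + 2 / cL) * norm (sqrt (real T * ln (real T)))"
      using eventually_ge_at_top[of N]
    proof eventually_elim
      case (elim T)
      \<comment> \<open>\<open>L1\<close> contributes \<open>cL\<close> and the sum contributes
        \<open>2 / cL\<close> to the constant, both at the rate of sqrt(T ln T).\<close>
      have "L1 cL T + S T \<le> (cL + 2 / cL) * sqrt (real T * ln (real T))"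
        using sum_ln_div_L1_le[OF cL, of T] by (simp add: S_def L1_def distrib_right)
      from mult_left_mono[OF this D0] main[OF elim] regret_nonneg[of T] elim
      show ?case by (simp add: N_def mult.assoc)
    qed
  qed
  ultimately show ?thesis by (simp add: S_def ps_def)
qed

end
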